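(* The contravariant functors $\mathcal V^a\colon \mathsf{PGPS}\to\mathsf{AlgFrm_{Sup}}$ and $\mathcal Y\colon \mathsf{AlgFrm_{Sup}}\to\mathsf{PGPS}$ establish a dual equivalence between the category $\mathsf{AlgFrm_{Sup}}$ of algebraic frames (with maps preserving arbitrary joins and compact elements) and the category $\mathsf{PGPS}$ of pointed generalized Priestley spaces (with generalized Priestley morphisms).
   Context: Algebraic frames. An element $k$ of a complete lattice $L$ is compact if $k\le\bigvee S$ implies $k\le\bigvee T$ for some finite $T\subseteq S$; $\mathsf K(L)$ is the set of compact elements. An algebraic frame is a frame in which every element is a join of compact elements. $\mathsf{AlgFrm_{Sup}}$ is the category of algebraic frames and maps preserving arbitrary joins and sending compact elements to compact elements (finite meets need not be preserved). Pointed generalized Priestley spaces. A Priestley space is a compact space $X$ with a partial order $\le$ such that $x\not\le y$ implies there is a clopen upset containing $x$ and missing $y$. If $X$ is a Priestley space with a distinguished subset $X_0$, a clopen upset $U$ is admissible if the set of maximal points of $X\setminus U$ is contained in $X_0$; $\mathcal A(X)$ is the set of admissible clopen upsets, and $\mathcal I_x=\{U\in\mathcal A(X)\mid x\notin U\}$. A family of sets is directed if any two members are contained in a member. A pointed generalized Priestley space is a tuple $(X,\tau,\le,X_0,m)$ such that: $(X,\tau,\le)$ is a Priestley space; $m$ is the unique maximum of $X$; $X_0$ is a dense subset of $X\setminus\{m\}$; for each $x\in X\setminus\{m\}$ there is $y\in X_0$ with $x\le y$; $x\in X_0$ iff $\mathcal I_x$ is nonempty and directed; $x\le y$ iff for all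 $U\in\mathcal A(X)$, $x\in U$ implies $y\in U$. For $R\subseteq X\times Y$ write $R[x]=\{y\mid x\mathrel R y\}$ and $\Box_RU=\{x\in X\mid R[x]\subseteq U\}$. A generalized Priestley morphism from $X$ to $Y$ is a relation $R\subseteq X\times Y$ such that (i) if $x\not\mathrel R y$ then there is $U\in\mathcal A(Y)$ with $R[x]\subseteq U$ and $y\notin U$; (ii) $U\in\mathcal A(Y)$ implies $\Box_RU\in\mathcal A(X)$. $\mathsf{PGPS}$ has these objects and morphisms; the identity on $X$ is $\le$, and the composite of $R\subseteq X\times Y$ and $S\subseteq Y\times Z$ is $S*R$, where $x\mathrel{(S*R)}z$ iff for all $U\in\mathcal A(Z)$, $x\in\Box_R\Box_SU$ implies $z\in U$. The functor $\mathcal V^a$. A closed upset $C$ of $X\in\mathsf{PGPS}$ is admissible if $X\setminus C={\downarrow}(X_0\setminus C)$. $\mathcal V^a(X)$ is the set of admissible closed upsets ordered by reverse inclusion $\supseteq$; for a morphism $R\subseteq X\times Y$, $\mathcal V^a(R)=\Box_R\colon\mathcal V^a(Y)\to\mathcal V^a(X)$. The functor $\mathcal Y$. In a complete lattice $L$, $a\ll b$ means: $b\le\bigvee S$ implies $a\le\bigvee T$ for some finite $T\subseteq S$. An element $p\ne1$ is prime if $a\wedge b\le p$ implies $a\le p$ or $b\le p$; it is pseudoprime if for all $n\ge1$, $a_1\wedge\dots\wedge a_n\ll p$ implies $a_i\le p$ for some $i$. Let $\mathsf P(L)$, $\mathsf{PP}(L)$ be the sets of prime and pseudoprime elements and $Y_L=\mathsf{PP}(L)\cup\{1\}$.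 Then $\mathcal Y(L)=(Y_L,\lambda,\le,\mathsf P(L),1)$, where $\le$ is the restricted order and $\lambda$ is the restriction to $Y_L$ of the topology on $L$ with subbasis $\{{\uparrow}k\mid k\in\mathsf K(L)\}\cup\{L\setminus{\uparrow}l\mid l\in\mathsf K(L)\}$. For $\alpha\colon L_1\to L_2$ in $\mathsf{AlgFrm_{Sup}}$ with right adjoint $r\colon L_2\to L_1$, $\mathcal Y(\alpha)=R_\alpha\subseteq Y_{L_2}\times Y_{L_1}$, where $p\mathrel{R_\alpha}q$ iff $r(p)\le q$. *)

theory Defs
  imports "HOL-Analysis.Analysis" "HOL-Algebra.Galois_Connection"
begin

text \<open>
  Objects are carrier-based structures on an arbitrary HOL type, and each notion of morphism is
  defined between objects living on possibly different types.  This is essential here: the frame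
  assigned to a space on \<open>'a\<close> lives on \<open>'a set\<close>, so no category of structures on a single type is
  closed under the two functors.
\<close>

section \<open>Algebraic frames\<close>

definition compact_elements :: "('a, 'b) gorder_scheme \<Rightarrow> 'a set" where
  "compact_elements L =
     {k \<in> carrier L. \<forall>S \<subseteq> carrier L. k \<sqsubseteq>\<^bsub>L\<^esub> \<Squnion>\<^bsub>L\<^esub>S \<longrightarrow>
        (\<exists>T \<subseteq> S. finite T \<and> k \<sqsubseteq>\<^bsub>L\<^esub> \<Squnion>\<^bsub>L\<^esub>T)}"

locale algebraic_frame = complete_lattice L for L (structure) +
  assumes meet_sup_distrib:
      "\<lbrakk>a \<in> carrier L; S \<subseteq> carrier L\<rbrakk> \<Longrightarrow> a \<sqinter> (\<Squnion>S) = \<Squnion>((\<lambda>s. a \<sqinter> s) ` S)"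
    and sup_of_compacts:
      "a \<in> carrier L \<Longrightarrow> \<exists>S \<subseteq> compact_elements L. a = \<Squnion>S"

text \<open>
  Morphisms are extensional functions, i.e.\ \<open>undefined\<close> off the carrier of the domain, so that
  equality of morphisms is equality in HOL.
\<close>

definition frm_hom :: "'a gorder \<Rightarrow> 'b gorder \<Rightarrow> ('a \<Rightarrow> 'b) set" where
  "frm_hom L M =
     {\<alpha> \<in> carrier L \<rightarrow>\<^sub>E carrier M. algebraic_frame L \<and> algebraic_frame M \<and>
        (\<forall>S \<subseteq> carrier L. \<alpha> (\<Squnion>\<^bsub>L\<^esub>S) = \<Squnion>\<^bsub>M\<^esub>(\<alpha> ` S)) \<and>
        (\<forall>k \<in> compact_elements L. \<alpha> k \<in> compact_elements M)}"

definition frm_id :: "'a gorder \<Rightarrow> 'a \<Rightarrow> 'a" where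
  "frm_id L = (\<lambda>a \<in> carrier L. a)"

definition frm_comp :: "'a gorder \<Rightarrow> ('b \<Rightarrow> 'c) \<Rightarrow> ('a \<Rightarrow> 'b) \<Rightarrow> 'a \<Rightarrow> 'c" where
  "frm_comp L \<beta> \<alpha> = compose (carrier L) \<beta> \<alpha>"

definition frm_iso :: "'a gorder \<Rightarrow> 'b gorder \<Rightarrow> ('a \<Rightarrow> 'b) set" where
  "frm_iso L M =
     {\<alpha> \<in> frm_hom L M. \<exists>\<beta> \<in> frm_hom M L.
        frm_comp L \<beta> \<alpha> = frm_id L \<and> frm_comp M \<alpha> \<beta> = frm_id M}"


section \<open>Pointed generalized Priestley spaces\<close>

record 'a pospace = "'a gorder" +
  topo :: "'a topology"
  dist_pts :: "'a set"
  max_pt :: 'a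

definition upset :: "('a, 'b) gorder_scheme \<Rightarrow> 'a set \<Rightarrow> bool" where
  "upset X U \<longleftrightarrow> U \<subseteq> carrier X \<and> (\<forall>x \<in> U. \<forall>y \<in> carrier X. x \<sqsubseteq>\<^bsub>X\<^esub> y \<longrightarrow> y \<in> U)"

definition down_closure :: "('a, 'b) gorder_scheme \<Rightarrow> 'a set \<Rightarrow> 'a set" where
  "down_closure X S = {x \<in> carrier X. \<exists>y \<in> S. x \<sqsubseteq>\<^bsub>X\<^esub> y}"

definition maximal_points :: "('a, 'b) gorder_scheme \<Rightarrow> 'a set \<Rightarrow> 'a set" where
  "maximal_points X S = {x \<in> S. \<forall>y \<in> S. x \<sqsubseteq>\<^bsub>X\<^esub> y \<longrightarrow> y = x}"

definition clopen_upset :: "'a pospace \<Rightarrow> 'a set \<Rightarrow> bool" where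
  "clopen_upset X U \<longleftrightarrow> openin (topo X) U \<and> closedin (topo X) U \<and> upset X U"

definition adm_clopen :: "'a pospace \<Rightarrow> 'a set set" where
  "adm_clopen X = {U. clopen_upset X U \<and> maximal_points X (carrier X - U) \<subseteq> dist_pts X}"

definition adm_missing :: "'a pospace \<Rightarrow> 'a \<Rightarrow> 'a set set" where
  "adm_missing X x = {U \<in> adm_clopen X. x \<notin> U}"

definition directed_family :: "'a set set \<Rightarrow> bool" where
  "directed_family \<F> \<longleftrightarrow> (\<forall>U \<in> \<F>. \<forall>V \<in> \<F>. \<exists>W \<in> \<F>. U \<subseteq> W \<and> V \<subseteq> W)"

locale priestley_space = partial_order X for X :: "'a pospace" (structure) +
  assumes topspace_topo: "topspace (topo X) = carrier X"
    and compact_topo: "compact_space (topo X)"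
    and separation:
      "\<lbrakk>x \<in> carrier X; y \<in> carrier X; \<not> x \<sqsubseteq> y\<rbrakk> \<Longrightarrow> \<exists>U. clopen_upset X U \<and> x \<in> U \<and> y \<notin> U"

locale pointed_gen_priestley_space = priestley_space +
  assumes max_pt_greatest: "greatest X (max_pt X) (carrier X)"
    and dist_pts_subset: "dist_pts X \<subseteq> carrier X - {max_pt X}"
    and dist_pts_dense:
      "subtopology (topo X) (carrier X - {max_pt X}) closure_of dist_pts X
         = carrier X - {max_pt X}"
    and dist_pts_above:
      "x \<in> carrier X - {max_pt X} \<Longrightarrow> \<exists>y \<in> dist_pts X. x \<sqsubseteq> y"
    and dist_pts_iff:
      "x \<in> carrier X \<Longrightarrow>
         x \<in> dist_pts X \<longleftrightarrow> adm_missing X x \<noteq> {} \<and> directed_family (adm_missing X x)"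
    and le_iff_adm:
      "\<lbrakk>x \<in> carrier X; y \<in> carrier X\<rbrakk> \<Longrightarrow>
         x \<sqsubseteq> y \<longleftrightarrow> (\<forall>U \<in> adm_clopen X. x \<in> U \<longrightarrow> y \<in> U)"

definition box :: "'a pospace \<Rightarrow> ('a \<times> 'b) set \<Rightarrow> 'b set \<Rightarrow> 'a set" where
  "box X R U = {x \<in> carrier X. R `` {x} \<subseteq> U}"

definition pgps_hom :: "'a pospace \<Rightarrow> 'b pospace \<Rightarrow> ('a \<times> 'b) set set" where
  "pgps_hom X Y =
     {R. R \<subseteq> carrier X \<times> carrier Y \<and>
         pointed_gen_priestley_space X \<and> pointed_gen_priestley_space Y \<and>
         (\<forall>x \<in> carrier X. \<forall>y \<in> carrier Y. (x, y) \<notin> R \<longrightarrow>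
            (\<exists>U \<in> adm_clopen Y. R `` {x} \<subseteq> U \<and> y \<notin> U)) \<and>
         (\<forall>U \<in> adm_clopen Y. box X R U \<in> adm_clopen X)}"

definition pgps_id :: "'a pospace \<Rightarrow> ('a \<times> 'a) set" where
  "pgps_id X = {(x, y) \<in> carrier X \<times> carrier X. x \<sqsubseteq>\<^bsub>X\<^esub> y}"

definition pgps_comp ::
  "'a pospace \<Rightarrow> 'b pospace \<Rightarrow> 'c pospace \<Rightarrow> ('b \<times> 'c) set \<Rightarrow> ('a \<times> 'b) set \<Rightarrow> ('a \<times> 'c) set" where
  "pgps_comp X Y Z S R =
     {(x, z) \<in> carrier X \<times> carrier Z.
        \<forall>U \<in> adm_clopen Z. x \<in> box X R (box Y S U) \<longrightarrow> z \<in> U}"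

definition pgps_iso :: "'a pospace \<Rightarrow> 'b pospace \<Rightarrow> ('a \<times> 'b) set set" where
  "pgps_iso X Y =
     {R \<in> pgps_hom X Y. \<exists>S \<in> pgps_hom Y X.
        pgps_comp X Y X S R = pgps_id X \<and> pgps_comp Y X Y R S = pgps_id Y}"


section \<open>The functor from spaces to frames\<close>

definition adm_closed :: "'a pospace \<Rightarrow> 'a set set" where
  "adm_closed X =
     {C. closedin (topo X) C \<and> upset X C \<and>
         carrier X - C = down_closure X (dist_pts X - C)}"

definition V_ob :: "'a pospace \<Rightarrow> 'a set gorder" where
  "V_ob X = \<lparr>carrier = adm_closed X, eq = (=), le = (\<lambda>C D. D \<subseteq> C)\<rparr>"

definition V_mor :: "'a pospace \<Rightarrow> 'b pospace \<Rightarrow> ('a \<times> 'b) set \<Rightarrow> 'b set \<Rightarrow> 'a set" where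
  "V_mor X Y R = (\<lambda>C \<in> carrier (V_ob Y). box X R C)"


section \<open>The functor from frames to spaces\<close>

definition way_below :: "('a, 'b) gorder_scheme \<Rightarrow> 'a \<Rightarrow> 'a \<Rightarrow> bool" where
  "way_below L a b \<longleftrightarrow>
     (\<forall>S \<subseteq> carrier L. b \<sqsubseteq>\<^bsub>L\<^esub> \<Squnion>\<^bsub>L\<^esub>S \<longrightarrow> (\<exists>T \<subseteq> S. finite T \<and> a \<sqsubseteq>\<^bsub>L\<^esub> \<Squnion>\<^bsub>L\<^esub>T))"

definition prime_elements :: "('a, 'b) gorder_scheme \<Rightarrow> 'a set" where
  "prime_elements L =
     {p \<in> carrier L. p \<noteq> \<top>\<^bsub>L\<^esub> \<and>
        (\<forall>a \<in> carrier L. \<forall>b \<in> carrier L. a \<sqinter>\<^bsub>L\<^esub> b \<sqsubseteq>\<^bsub>L\<^esub> p \<longrightarrow> a \<sqsubseteq>\<^bsub>L\<^esub> p \<or> b \<sqsubseteq>\<^bsub>L\<^esub> p)}"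

definition pseudoprime_elements :: "('a, 'b) gorder_scheme \<Rightarrow> 'a set" where
  "pseudoprime_elements L =
     {p \<in> carrier L. p \<noteq> \<top>\<^bsub>L\<^esub> \<and>
        (\<forall>n \<ge> 1. \<forall>a \<in> {1..n::nat} \<rightarrow> carrier L.
           way_below L (\<Sqinter>\<^bsub>L\<^esub>(a ` {1..n})) p \<longrightarrow> (\<exists>i \<in> {1..n}. a i \<sqsubseteq>\<^bsub>L\<^esub> p))}"

definition Y_carrier :: "('a, 'b) gorder_scheme \<Rightarrow> 'a set" where
  "Y_carrier L = pseudoprime_elements L \<union> {\<top>\<^bsub>L\<^esub>}"

definition principal_up :: "('a, 'b) gorder_scheme \<Rightarrow> 'a \<Rightarrow> 'a set" where
  "principal_up L a = {x \<in> carrier L. a \<sqsubseteq>\<^bsub>L\<^esub> x}"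

text \<open>
  The topological space of \<open>topology_generated_by \<B>\<close> is \<open>\<Union>\<B>\<close>.  Here this is all of \<open>carrier L\<close>,
  because the bottom element is compact.
\<close>

definition lambda_topology :: "('a, 'b) gorder_scheme \<Rightarrow> 'a topology" where
  "lambda_topology L = topology_generated_by
     ({principal_up L k | k. k \<in> compact_elements L} \<union>
      {carrier L - principal_up L l | l. l \<in> compact_elements L})"

definition Y_ob :: "'a gorder \<Rightarrow> 'a pospace" where
  "Y_ob L = \<lparr>carrier = Y_carrier L, eq = (=), le = (\<sqsubseteq>\<^bsub>L\<^esub>),
             topo = subtopology (lambda_topology L) (Y_carrier L),
             dist_pts = prime_elements L, max_pt = \<top>\<^bsub>L\<^esub>\<rparr>"

text \<open>The upper adjoint is uniquely determined on the carrier of its domain, where it is used.\<close>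

definition right_adjoint :: "'a gorder \<Rightarrow> 'b gorder \<Rightarrow> ('a \<Rightarrow> 'b) \<Rightarrow> 'b \<Rightarrow> 'a" where
  "right_adjoint L M \<alpha> =
     (SOME r. galois_connection \<lparr>orderA = L, orderB = M, lower = \<alpha>, upper = r\<rparr>)"

definition Y_mor :: "'a gorder \<Rightarrow> 'b gorder \<Rightarrow> ('a \<Rightarrow> 'b) \<Rightarrow> ('b \<times> 'a) set" where
  "Y_mor L M \<alpha> =
     {(p, q) \<in> Y_carrier M \<times> Y_carrier L. right_adjoint L M \<alpha> p \<sqsubseteq>\<^bsub>L\<^esub> q}"


section \<open>Components of the two natural isomorphisms\<close>

text \<open>
  A family of morphisms indexed by the objects on \<^emph>\<open>all\<close> types cannot be quantified existentially
  in HOL, so the natural isomorphisms of the dual equivalence are given as polymorphic constants.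
  The second one is the relation \<open>{(x, C). f x \<le> C}\<close> induced by the map \<open>f x = {y. x \<le> y}\<close>, where
  \<open>\<le>\<close> on sets is reverse inclusion.
\<close>

definition frm_unit :: "'a gorder \<Rightarrow> 'a \<Rightarrow> 'a set" where
  "frm_unit L = (\<lambda>a \<in> carrier L. principal_up L a \<inter> Y_carrier L)"

definition pgps_unit :: "'a pospace \<Rightarrow> ('a \<times> 'a set) set" where
  "pgps_unit X =
     {(x, C) \<in> carrier X \<times> carrier (Y_ob (V_ob X)). principal_up X x \<sqsubseteq>\<^bsub>Y_ob (V_ob X)\<^esub> C}"

end

theory Submission
  imports Defs
begin

text \<open>
  Both functors are governed by one observation about spaces: a generalized Priestley morphism
  \<open>R\<close> from \<open>X\<close> to \<open>Y\<close> is determined by the map \<open>\<box>\<^sub>R\<close> from the admissible clopen upsets of \<open>Y\<close>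
  to those of \<open>X\<close>, and composition of morphisms is composition of these maps
  (\<open>pgps_hom_eqI\<close>, \<open>box_pgps_comp\<close>).  All equations between morphisms of spaces, that is the laws
  of the category, functoriality of \<open>\<Y>\<close> and naturality of the unit, are therefore checked on
  admissible clopen upsets.

  On the side of spaces, a closed upset missing a point of \<open>X\<^sub>0\<close> can be enclosed in one admissible
  clopen upset missing that point, by compactness and because the admissible clopen upsets missing the
  point form a directed family (\<open>adm_clopen_separates_dist_pt\<close>).  Hence admissible closed upsets
  are exactly the intersections of admissible clopen ones, which are the compact elements of the
  lattice, and taking the trace on \<open>X\<^sub>0\<close> embeds the lattice into the subsets of \<open>X\<^sub>0\<close> in such a way
  that joins become intersections and finite meets become unions (\<open>V_ob_finite_inf_trace\<close>).  This
  makes it a distributive algebraic lattice, that is an algebraic frame.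

  On the side of frames, the tool is spatiality (\<open>prime_above_separating\<close>).  It identifies the
  admissible closed upsets of the space of a frame \<open>L\<close> as the sets \<open>\<up>a\<close> with \<open>a\<close> in \<open>L\<close>, and the
  clopen ones as those with \<open>a\<close> compact (\<open>adm_closed_eq_Y_up\<close>, \<open>adm_clopen_Y_ob\<close>).  In these
  terms directedness of the admissible clopen upsets missing a point means primeness, density of the
  primes is what pseudoprimeness asserts, and the box of \<open>\<Y>(\<alpha>)\<close> sends \<open>\<up>a\<close> to \<open>\<up>(\<alpha> a)\<close>
  (\<open>box_Y_mor\<close>).  So \<open>a \<mapsto> \<up>a\<close> is an order isomorphism of \<open>L\<close> onto the frame of its space and is
  natural.

  For a space \<open>X\<close>, the set \<open>\<up>x\<close> is pseudoprime or the top element in the frame of \<open>X\<close>, by density of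
  \<open>X\<^sub>0\<close> (\<open>principal_up_in_Y_carrier\<close>).  The admissible clopen upsets of the double dual are the
  sets \<open>\<up>U\<close> for \<open>U\<close> an admissible clopen upset of \<open>X\<close>, and the box of the unit sends \<open>\<up>U\<close> to \<open>U\<close>.
  As this is a bijection whose inverse is also a box, the unit is an isomorphism.
\<close>

section \<open>Compact elements of algebraic frames\<close>

lemma (in partial_order) chain_finite_upper_bound:
  assumes C: "C \<subseteq> carrier L" "C \<noteq> {}"
    and tot: "\<And>x y. \<lbrakk>x \<in> C; y \<in> C\<rbrakk> \<Longrightarrow> x \<sqsubseteq> y \<or> y \<sqsubseteq> x"
    and "finite T" "T \<subseteq> C"
  shows "\<exists>u\<in>C. \<forall>t\<in>T. t \<sqsubseteq> u"
  using \<open>finite T\<close> \<open>T \<subseteq> C\<close>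
proof (induction T)
  case empty
  then show ?case using C by blast
next
  case (insert t T)
  then obtain u where u: "u \<in> C" "\<forall>s\<in>T. s \<sqsubseteq> u"
    by blast
  have t: "t \<in> C" and T: "T \<subseteq> C"
    using insert by auto
  show ?case
  proof (cases "t \<sqsubseteq> u")
    case True
    then show ?thesis using u by blast
  next
    case False
    then have "u \<sqsubseteq> t"
      using tot[OF t u(1)] by blast
    then have "\<forall>x\<in>insert t T. x \<sqsubseteq> t"
      using le_trans[of _ u t] u t C T by (auto simp: subset_iff)
    then show ?thesis using t by blast
  qed
qed

context complete_lattice
begin

lemma compact_elements_carrier: "k \<in> compact_elements L \<Longrightarrow> k \<in> carrier L"
  by (simp add: compact_elements_def)

lemma compact_elementsD:
  assumes "k \<in> compact_elements L" "S \<subseteq> carrier L" "k \<sqsubseteq> \<Squnion>S"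
  shows "\<exists>T\<subseteq>S. finite T \<and> k \<sqsubseteq> \<Squnion>T"
  using assms unfolding compact_elements_def by blast

lemma sup_mono_set:
  assumes "A \<subseteq> B" "B \<subseteq> carrier L"
  shows "\<Squnion>A \<sqsubseteq> \<Squnion>B"
  using assms by (intro sup_least sup_closed sup_upper[of B]) auto

lemma le_sup_trans:
  assumes "a \<sqsubseteq> b" "b \<in> B" "B \<subseteq> carrier L" "a \<in> carrier L"
  shows "a \<sqsubseteq> \<Squnion>B"
  using assms by (intro le_trans[OF \<open>a \<sqsubseteq> b\<close> sup_upper]) auto

lemma sup_le_iff:
  assumes A: "A \<subseteq> carrier L" and z: "z \<in> carrier L"
  shows "\<Squnion>A \<sqsubseteq> z \<longleftrightarrow> (\<forall>a\<in>A. a \<sqsubseteq> z)"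
proof
  assume "\<Squnion>A \<sqsubseteq> z"
  then show "\<forall>a\<in>A. a \<sqsubseteq> z"
    using le_trans[OF sup_upper[OF A]] A z by auto
next
  assume "\<forall>a\<in>A. a \<sqsubseteq> z"
  then show "\<Squnion>A \<sqsubseteq> z"
    using A z by (intro sup_least) auto
qed

lemma le_inf_iff:
  assumes A: "A \<subseteq> carrier L" and z: "z \<in> carrier L"
  shows "z \<sqsubseteq> \<Sqinter>A \<longleftrightarrow> (\<forall>a\<in>A. z \<sqsubseteq> a)"
proof
  assume *: "z \<sqsubseteq> \<Sqinter>A"
  show "\<forall>a\<in>A. z \<sqsubseteq> a"
    using le_trans[OF * inf_lower[OF A]] A z by auto
next
  assume "\<forall>a\<in>A. z \<sqsubseteq> a"
  then show "z \<sqsubseteq> \<Sqinter>A"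
    using A z by (intro inf_greatest) auto
qed

lemma finite_sup_compact:
  assumes "finite F" and F: "F \<subseteq> compact_elements L"
  shows "\<Squnion>F \<in> compact_elements L"
proof -
  have carr: "F \<subseteq> carrier L"
    using F compact_elements_carrier by blast
  have "\<exists>T\<subseteq>S. finite T \<and> \<Squnion>F \<sqsubseteq> \<Squnion>T" if S: "S \<subseteq> carrier L" "\<Squnion>F \<sqsubseteq> \<Squnion>S" for S
  proof -
    have "\<exists>T\<subseteq>S. finite T \<and> f \<sqsubseteq> \<Squnion>T" if "f \<in> F" for f
    proof -
      have "f \<sqsubseteq> \<Squnion>S"
        by (rule le_trans[OF sup_upper[OF carr that] S(2)]) (use S(1) carr that in \<open>simp_all add: subsetD\<close>)
      then show ?thesis
        using compact_elementsD[OF subsetD[OF F that] S(1)] by blast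
    qed
    then obtain T where T: "\<And>f. f \<in> F \<Longrightarrow> T f \<subseteq> S \<and> finite (T f) \<and> f \<sqsubseteq> \<Squnion>(T f)"
      by metis
    have sub: "\<Union>(T ` F) \<subseteq> S"
      using T by blast
    have "\<Squnion>F \<sqsubseteq> \<Squnion>(\<Union>(T ` F))"
    proof (rule sup_least)
      fix f assume f: "f \<in> F"
      have "\<Squnion>(T f) \<sqsubseteq> \<Squnion>(\<Union>(T ` F))"
        using f sub S by (intro sup_mono_set) auto
      then show "f \<sqsubseteq> \<Squnion>(\<Union>(T ` F))"
        using le_trans[of f "\<Squnion>(T f)"] T[OF f] carr f sub S(1) by (auto simp: subset_iff)
    qed (use carr sub S in auto)
    then show ?thesis
      using sub T \<open>finite F\<close> by (intro exI[of _ "\<Union>(T ` F)"]) auto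
  qed
  then show ?thesis
    unfolding compact_elements_def using carr by (intro CollectI conjI allI impI sup_closed)
qed

lemma bottom_compact: "\<bottom> \<in> compact_elements L"
  using finite_sup_compact[of "{}"] weak_sup_empty by (simp add: eq_is_equal)

end

context algebraic_frame
begin

lemma compact_below_not_below:
  assumes "a \<in> carrier L" "b \<in> carrier L" "\<not> a \<sqsubseteq> b"
  obtains k where "k \<in> compact_elements L" "k \<sqsubseteq> a" "\<not> k \<sqsubseteq> b"
proof -
  obtain S where S: "S \<subseteq> compact_elements L" "a = \<Squnion>S"
    using sup_of_compacts[OF assms(1)] by metis
  have carr: "S \<subseteq> carrier L"
    using S compact_elements_carrier by blast
  then obtain k where "k \<in> S" "\<not> k \<sqsubseteq> b"
    using sup_le_iff[OF carr assms(2)] S(2) assms(3) by blast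
  then show thesis
    using S carr that sup_upper[OF carr] by blast
qed

text \<open>
  An element \<open>b\<close> is a join of compact elements, and if finitely many of these suffice to cover \<open>a\<close>
  then their join is again compact.
\<close>

lemma way_below_iff_compact_between:
  assumes "a \<in> carrier L" "b \<in> carrier L"
  shows "way_below L a b \<longleftrightarrow> (\<exists>k \<in> compact_elements L. a \<sqsubseteq> k \<and> k \<sqsubseteq> b)"
proof
  assume wb: "way_below L a b"
  obtain S where S: "S \<subseteq> compact_elements L" "b = \<Squnion>S"
    using sup_of_compacts[OF assms(2)] by metis
  have carr: "S \<subseteq> carrier L"
    using S compact_elements_carrier by blast
  have "b \<sqsubseteq> \<Squnion>S"
    using S assms by auto
  then obtain T where T: "T \<subseteq> S" "finite T" "a \<sqsubseteq> \<Squnion>T"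
    using wb[unfolded way_below_def, rule_format, OF carr] by blast
  then have "\<Squnion>T \<in> compact_elements L"
    using S by (intro finite_sup_compact) auto
  moreover have "\<Squnion>T \<sqsubseteq> b"
    using T S carr by (simp add: sup_mono_set)
  ultimately show "\<exists>k \<in> compact_elements L. a \<sqsubseteq> k \<and> k \<sqsubseteq> b"
    using T by blast
next
  assume "\<exists>k \<in> compact_elements L. a \<sqsubseteq> k \<and> k \<sqsubseteq> b"
  then obtain k where k: "k \<in> compact_elements L" "a \<sqsubseteq> k" "k \<sqsubseteq> b"
    by blast
  then have kc: "k \<in> carrier L"
    using compact_elements_carrier by blast
  show "way_below L a b"
    unfolding way_below_def
  proof (intro allI impI)
    fix S assume S: "S \<subseteq> carrier L" "b \<sqsubseteq> \<Squnion>S"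
    then have "k \<sqsubseteq> \<Squnion>S"
      using le_trans[OF k(3)] kc assms by auto
    then obtain T where T: "T \<subseteq> S" "finite T" "k \<sqsubseteq> \<Squnion>T"
      using compact_elementsD[OF k(1) S(1)] by blast
    then have "a \<sqsubseteq> \<Squnion>T"
      using le_trans[OF k(2)] kc assms S by (auto simp: subset_iff)
    then show "\<exists>T\<subseteq>S. finite T \<and> a \<sqsubseteq> \<Squnion>T"
      using T by blast
  qed
qed


section \<open>Prime and pseudoprime elements\<close>

text \<open>
  Expanding the meet by distributivity gives terms that are all below \<open>q\<close>.  This is the step that
  turns maximality of \<open>q\<close> into primeness.
\<close>

lemma join_meet_join_le:
  assumes "a \<in> carrier L" "b \<in> carrier L" "q \<in> carrier L" "a \<sqinter> b \<sqsubseteq> q"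
  shows "(q \<squnion> a) \<sqinter> (q \<squnion> b) \<sqsubseteq> q"
proof -
  have qa: "q \<squnion> a \<in> carrier L"
    using assms by simp
  have "b \<sqinter> (q \<squnion> a) = \<Squnion>((\<lambda>s. b \<sqinter> s) ` {q, a})"
    using assms unfolding join_def by (intro meet_sup_distrib) auto
  also have "\<dots> \<sqsubseteq> q"
    using assms by (intro sup_least) (auto simp: meet_right meet_comm[where x=b and y=a])
  finally have *: "(q \<squnion> a) \<sqinter> b \<sqsubseteq> q"
    by (simp add: meet_comm)
  have "(q \<squnion> a) \<sqinter> (q \<squnion> b) = \<Squnion>((\<lambda>s. (q \<squnion> a) \<sqinter> s) ` {q, b})"
    using assms unfolding join_def[where x=q and y=b] by (intro meet_sup_distrib) auto
  also have "\<dots> \<sqsubseteq> q"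
    using assms * by (intro sup_least) (auto simp: meet_right)
  finally show ?thesis .
qed

lemma prime_elements_carrier: "p \<in> prime_elements L \<Longrightarrow> p \<in> carrier L"
  by (simp add: prime_elements_def)

text \<open>
  Algebraic frames are spatial.  Replace \<open>b\<close> by a compact element \<open>c\<close> below it.  A chain of elements
  that are not above \<open>c\<close> has a join that is not above \<open>c\<close>, because \<open>c\<close> is compact; so there is a
  maximal \<open>q\<close> above \<open>a\<close> but not above \<open>c\<close>.  If \<open>x\<close> and \<open>y\<close> are not below \<open>q\<close>, then \<open>q \<squnion> x\<close> and
  \<open>q \<squnion> y\<close> are above \<open>c\<close>, hence so is their meet, and therefore \<open>x \<sqinter> y\<close> is not below \<open>q\<close>.
\<close>

lemma prime_above_separating:
  assumes a: "a \<in> carrier L" and b: "b \<in> carrier L" and "\<not> b \<sqsubseteq> a"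
  obtains q where "q \<in> prime_elements L" "a \<sqsubseteq> q" "\<not> b \<sqsubseteq> q"
proof -
  obtain c where c: "c \<in> compact_elements L" "c \<sqsubseteq> b" "\<not> c \<sqsubseteq> a"
    using compact_below_not_below[OF b a \<open>\<not> b \<sqsubseteq> a\<close>] by blast
  then have cc: "c \<in> carrier L"
    using compact_elements_carrier by blast
  define A where "A = {x \<in> carrier L. a \<sqsubseteq> x \<and> \<not> c \<sqsubseteq> x}"
  have carrA: "A \<subseteq> carrier L"
    by (auto simp: A_def)
  have "\<exists>m\<in>A. \<forall>x\<in>A. m \<sqsubseteq> x \<longrightarrow> x = m"
  proof (rule predicate_Zorn)
    show "partial_order_on A (relation_of (\<sqsubseteq>) A)"
      using carrA
      by (intro partial_order_on_relation_ofI) (auto intro: le_trans le_antisym)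
    fix C assume C: "C \<in> Chains (relation_of (\<sqsubseteq>) A)"
    then have CA: "C \<subseteq> A" and tot: "\<And>x y. x \<in> C \<Longrightarrow> y \<in> C \<Longrightarrow> x \<sqsubseteq> y \<or> y \<sqsubseteq> x"
      unfolding Chains_def relation_of_def by auto
    have carrC: "C \<subseteq> carrier L"
      using CA carrA by blast
    show "\<exists>u\<in>A. \<forall>x\<in>C. x \<sqsubseteq> u"
    proof (cases "C = {}")
      case True
      then show ?thesis
        using a c by (auto simp: A_def)
    next
      case False
      then obtain x0 where x0: "x0 \<in> C"
        by blast
      have "\<not> c \<sqsubseteq> \<Squnion>C"
      proof
        assume "c \<sqsubseteq> \<Squnion>C"
        then obtain T where T: "T \<subseteq> C" "finite T" "c \<sqsubseteq> \<Squnion>T"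
          using compact_elementsD[OF c(1) carrC] by blast
        then obtain u where u: "u \<in> C" "\<forall>t\<in>T. t \<sqsubseteq> u"
          using chain_finite_upper_bound[OF carrC False tot] by metis
        then have "\<Squnion>T \<sqsubseteq> u"
          using T carrC by (intro sup_least) auto
        then have "c \<sqsubseteq> u"
          using le_trans[OF T(3)] T(1) u(1) carrC cc by (auto simp: subset_iff)
        then show False
          using u CA by (auto simp: A_def)
      qed
      moreover have "a \<sqsubseteq> \<Squnion>C"
        using x0 CA a carrC by (intro le_sup_trans[of a x0]) (auto simp: A_def)
      ultimately show ?thesis
        using carrC by (intro bexI[of _ "\<Squnion>C"]) (auto simp: A_def sup_upper)
    qed
  qed
  then obtain q where q: "q \<in> A" and qmax: "\<And>x. x \<in> A \<Longrightarrow> q \<sqsubseteq> x \<Longrightarrow> x = q"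
    by blast
  have qc: "q \<in> carrier L" "a \<sqsubseteq> q" "\<not> c \<sqsubseteq> q"
    using q by (auto simp: A_def)
  have grow: "c \<sqsubseteq> q \<squnion> x" if "x \<in> carrier L" "\<not> x \<sqsubseteq> q" for x
  proof (rule ccontr)
    assume "\<not> c \<sqsubseteq> q \<squnion> x"
    moreover have "a \<sqsubseteq> q \<squnion> x"
      using le_trans[OF qc(2) join_left] qc that a by auto
    ultimately have "q \<squnion> x \<in> A"
      using qc that by (auto simp: A_def)
    then have "q \<squnion> x = q"
      using qmax qc that join_left by blast
    then show False
      using that qc join_right by metis
  qed
  have "q \<in> prime_elements L"
    unfolding prime_elements_def
  proof (intro CollectI conjI ballI impI)
    show "q \<noteq> \<top>"
      using qc cc by auto
    fix x y assume xy: "x \<in> carrier L" "y \<in> carrier L" "x \<sqinter> y \<sqsubseteq> q"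
    show "x \<sqsubseteq> q \<or> y \<sqsubseteq> q"
    proof (rule ccontr)
      assume "\<not> (x \<sqsubseteq> q \<or> y \<sqsubseteq> q)"
      then have "c \<sqsubseteq> (q \<squnion> x) \<sqinter> (q \<squnion> y)"
        using grow xy qc cc by (simp add: meet_le)
      moreover have "(q \<squnion> x) \<sqinter> (q \<squnion> y) \<sqsubseteq> q"
        using join_meet_join_le[OF xy(1,2) qc(1) xy(3)] .
      ultimately show False
        using qc cc xy le_trans[of c "(q \<squnion> x) \<sqinter> (q \<squnion> y)" q] by auto
    qed
  qed (use qc in auto)
  moreover have "\<not> b \<sqsubseteq> q"
    using c b cc qc le_trans[of c b q] by auto
  ultimately show thesis
    using that qc by blast
qed

lemma le_iff_primes:
  assumes "a \<in> carrier L" "b \<in> carrier L"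
  shows "a \<sqsubseteq> b \<longleftrightarrow> (\<forall>q \<in> prime_elements L. b \<sqsubseteq> q \<longrightarrow> a \<sqsubseteq> q)"
proof
  assume "a \<sqsubseteq> b"
  show "\<forall>q \<in> prime_elements L. b \<sqsubseteq> q \<longrightarrow> a \<sqsubseteq> q"
  proof (intro ballI impI)
    fix q assume "q \<in> prime_elements L" "b \<sqsubseteq> q"
    then show "a \<sqsubseteq> q"
      using le_trans[OF \<open>a \<sqsubseteq> b\<close>, of q] assms by (simp add: prime_elements_def)
  qed
next
  assume *: "\<forall>q \<in> prime_elements L. b \<sqsubseteq> q \<longrightarrow> a \<sqsubseteq> q"
  show "a \<sqsubseteq> b"
  proof (rule ccontr)
    assume "\<not> a \<sqsubseteq> b"
    then obtain q where "q \<in> prime_elements L" "b \<sqsubseteq> q" "\<not> a \<sqsubseteq> q"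
      using prime_above_separating[OF assms(2,1)] by metis
    then show False
      using * by blast
  qed
qed

lemma prime_finite_inf:
  assumes p: "p \<in> prime_elements L"
    and "finite F" "F \<noteq> {}" "F \<subseteq> carrier L" "\<Sqinter>F \<sqsubseteq> p"
  shows "\<exists>f\<in>F. f \<sqsubseteq> p"
  using assms(2-)
proof (induction F rule: finite_ne_induct)
  case (singleton x)
  then show ?case by simp
next
  case (insert x F)
  have "\<Sqinter>(insert x F) = x \<sqinter> \<Sqinter>F"
    using weak_inf_insert insert.prems by (simp add: eq_is_equal)
  then have "x \<sqsubseteq> p \<or> \<Sqinter>F \<sqsubseteq> p"
    using p insert.prems by (simp add: prime_elements_def)
  then show ?case
    using insert by auto
qed

lemma pseudoprime_elements_carrier: "p \<in> pseudoprime_elements L \<Longrightarrow> p \<in> carrier L"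
  by (simp add: pseudoprime_elements_def)

lemma pseudoprime_elementsD:
  assumes p: "p \<in> pseudoprime_elements L"
    and F: "finite F" "F \<noteq> {}" "F \<subseteq> carrier L"
    and k: "k \<in> compact_elements L" "\<Sqinter>F \<sqsubseteq> k" "k \<sqsubseteq> p"
  shows "\<exists>f\<in>F. f \<sqsubseteq> p"
proof -
  obtain h where h: "bij_betw h {1..card F} F"
    using ex_bij_betw_nat_finite_1[OF F(1)] by blast
  then have im: "h ` {1..card F} = F"
    by (simp add: bij_betw_def)
  have "way_below L (\<Sqinter>(h ` {1..card F})) p"
    using k F im pseudoprime_elements_carrier[OF p] way_below_iff_compact_between[of "\<Sqinter>F" p] by auto
  moreover have "1 \<le> card F"
    using F by (simp add: card_gt_0_iff Suc_leI)
  moreover have "h \<in> {1..card F} \<rightarrow> carrier L"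
    using im F by blast
  ultimately show ?thesis
    using p im unfolding pseudoprime_elements_def by blast
qed

text \<open>
  Shrinking the given elements only shrinks their meet, and an element not below \<open>p\<close> can be shrunk
  to a compact element not below \<open>p\<close>.  So pseudoprimeness may be tested on compact elements, that is,
  on the elements that define the subbasic open sets of the topology.
\<close>

lemma pseudoprime_elementsI:
  assumes p: "p \<in> carrier L" "p \<noteq> \<top>"
    and *: "\<And>F k. \<lbrakk>finite F; F \<noteq> {}; F \<subseteq> compact_elements L; k \<in> compact_elements L;
                 \<Sqinter>F \<sqsubseteq> k; k \<sqsubseteq> p\<rbrakk> \<Longrightarrow> \<exists>f\<in>F. f \<sqsubseteq> p"
  shows "p \<in> pseudoprime_elements L"
  unfolding pseudoprime_elements_def
proof (intro CollectI conjI allI impI ballI)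
  fix n :: nat and h
  assume n: "1 \<le> n" and h: "h \<in> {1..n} \<rightarrow> carrier L" and wb: "way_below L (\<Sqinter>(h ` {1..n})) p"
  have hc: "h ` {1..n} \<subseteq> carrier L"
    using h by blast
  obtain k where k: "k \<in> compact_elements L" "\<Sqinter>(h ` {1..n}) \<sqsubseteq> k" "k \<sqsubseteq> p"
    using wb way_below_iff_compact_between[OF inf_closed[OF hc] p(1)] by blast
  show "\<exists>i\<in>{1..n}. h i \<sqsubseteq> p"
  proof (rule ccontr)
    assume neg: "\<not> (\<exists>i\<in>{1..n}. h i \<sqsubseteq> p)"
    have "\<exists>c \<in> compact_elements L. c \<sqsubseteq> h i \<and> \<not> c \<sqsubseteq> p" if "i \<in> {1..n}" for i
    proof -
      have "h i \<in> carrier L" "\<not> h i \<sqsubseteq> p"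
        using h neg that by auto
      then show ?thesis
        using compact_below_not_below[of "h i" p] p by metis
    qed
    then obtain c where c: "\<And>i. i \<in> {1..n} \<Longrightarrow> c i \<in> compact_elements L \<and> c i \<sqsubseteq> h i \<and> \<not> c i \<sqsubseteq> p"
      by metis
    have cc: "c ` {1..n} \<subseteq> carrier L"
      using c compact_elements_carrier by blast
    have "\<Sqinter>(c ` {1..n}) \<sqsubseteq> \<Sqinter>(h ` {1..n})"
    proof (rule inf_greatest)
      fix x assume "x \<in> h ` {1..n}"
      then obtain i where i: "i \<in> {1..n}" "x = h i"
        by blast
      then have "\<Sqinter>(c ` {1..n}) \<sqsubseteq> c i"
        using cc by (intro inf_lower) auto
      moreover have "c i \<in> carrier L" "h i \<in> carrier L"
        using i cc hc by blast+
      ultimately show "\<Sqinter>(c ` {1..n}) \<sqsubseteq> x"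
        using le_trans[of "\<Sqinter>(c ` {1..n})" "c i" x] c[OF i(1)] i cc by auto
    qed (use cc hc in auto)
    then have "\<Sqinter>(c ` {1..n}) \<sqsubseteq> k"
      using le_trans[OF _ k(2)] k cc hc compact_elements_carrier by auto
    then have "\<exists>f\<in>c ` {1..n}. f \<sqsubseteq> p"
      using * k c n by (intro *[of "c ` {1..n}" k]) auto
    then show False
      using c by auto
  qed
qed (use p in auto)

lemma prime_imp_pseudoprime: "prime_elements L \<subseteq> pseudoprime_elements L"
proof
  fix p assume p: "p \<in> prime_elements L"
  show "p \<in> pseudoprime_elements L"
  proof (rule pseudoprime_elementsI)
    fix F k assume F: "finite F" "F \<noteq> {}" "F \<subseteq> compact_elements L" "k \<in> compact_elements L"
      and k: "\<Sqinter>F \<sqsubseteq> k" "k \<sqsubseteq> p"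
    have "F \<subseteq> carrier L"
      using F compact_elements_carrier by blast
    moreover have "\<Sqinter>F \<sqsubseteq> p"
      using le_trans[OF k] F calculation compact_elements_carrier prime_elements_carrier[OF p]
      by auto
    ultimately show "\<exists>f\<in>F. f \<sqsubseteq> p"
      using prime_finite_inf[OF p F(1,2)] by blast
  qed (use p in \<open>auto simp: prime_elements_def\<close>)
qed

lemma Y_carrier_subset: "Y_carrier L \<subseteq> carrier L"
  using pseudoprime_elements_carrier by (auto simp: Y_carrier_def)

lemma prime_in_Y_carrier:
  assumes "p \<in> prime_elements L" shows "p \<in> Y_carrier L"
  using assms prime_imp_pseudoprime by (auto simp: Y_carrier_def)

end


section \<open>The topology of an algebraic frame\<close>

text \<open>
  The right-hand side allows only nonempty finite intersections of members of the subbase, whereas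
  Alexander's subbase theorem speaks about the left-hand side.
\<close>

lemma topology_generated_by_subbase:
  "topology (arbitrary union_of (finite intersection_of (\<lambda>x. x \<in> \<B>) relative_to \<Union>\<B>))
     = topology_generated_by \<B>" (is "?T = _")
proof -
  have "openin ?T B" if "B \<in> \<B>" for B
  proof -
    have "(finite intersection_of (\<lambda>x. x \<in> \<B>) relative_to \<Union>\<B>) (\<Union>\<B> \<inter> B)"
      by (rule relative_to_inc, rule finite_intersection_of_inc) (fact that)
    moreover have "\<Union>\<B> \<inter> B = B"
      using that by blast
    ultimately show ?thesis
      by (simp add: openin_subbase arbitrary_union_of_inc)
  qed
  then have "generate_topology_on \<B> U \<Longrightarrow> openin ?T U" for U
    using generate_topology_on_coarsest[OF istopology_openin] by metis
  moreover have "openin ?T U \<Longrightarrow> openin (topology_generated_by \<B>) U" for U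
  proof (rule minimal_topology_subbase)
    show "openin (topology_generated_by \<B>) (\<Union>\<B>)"
      using openin_topspace[of "topology_generated_by \<B>"] by simp
  qed (auto intro: topology_generated_by_Basis)
  ultimately show ?thesis
    by (metis topology_eq openin_topology_generated_by_iff)
qed

context algebraic_frame
begin

lemma topspace_lambda: "topspace (lambda_topology L) = carrier L"
proof -
  have "carrier L = principal_up L \<bottom>"
    by (auto simp: principal_up_def)
  then show ?thesis
    using bottom_compact unfolding lambda_topology_def topology_generated_by_topspace
    by (auto simp: principal_up_def)
qed

lemma openin_principal_up:
  assumes "k \<in> compact_elements L"
  shows "openin (lambda_topology L) (principal_up L k)"
  unfolding lambda_topology_def using assms by (intro topology_generated_by_Basis) blast

lemma closedin_principal_up:
  assumes "k \<in> compact_elements L"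
  shows "closedin (lambda_topology L) (principal_up L k)"
proof -
  have "openin (lambda_topology L) (carrier L - principal_up L k)"
    unfolding lambda_topology_def using assms by (intro topology_generated_by_Basis) blast
  then show ?thesis
    by (auto simp: closedin_def topspace_lambda principal_up_def)
qed

text \<open>
  A single compact element \<open>k\<close> suffices on the positive side, since \<open>\<up>k \<inter> \<up>j = \<up>(k \<squnion> j)\<close> and finite
  joins of compact elements are compact.
\<close>

lemma lambda_basic_nbhd:
  assumes "openin (lambda_topology L) U" "p \<in> U"
  shows "\<exists>k F. k \<in> compact_elements L \<and> finite F \<and> F \<subseteq> compact_elements L \<and> k \<sqsubseteq> p \<and>
           (\<forall>l\<in>F. \<not> l \<sqsubseteq> p) \<and> (\<forall>x\<in>carrier L. k \<sqsubseteq> x \<and> (\<forall>l\<in>F. \<not> l \<sqsubseteq> x) \<longrightarrow> x \<in> U)"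
proof -
  have "p \<in> carrier L"
    using assms topspace_lambda openin_subset by blast
  have "generate_topology_on ({principal_up L k | k. k \<in> compact_elements L} \<union>
      {carrier L - principal_up L l | l. l \<in> compact_elements L}) U"
    using assms(1) unfolding lambda_topology_def by (rule openin_topology_generated_by)
  then show ?thesis
    using assms(2)
  proof induction
    case Empty
    then show ?case by simp
  next
    case (UN A)
    then obtain V where V: "V \<in> A" "p \<in> V"
      by blast
    have sub: "V \<subseteq> \<Union>A"
      using V by blast
    show ?case
      using UN.IH[OF V] subsetD[OF sub] by meson
  next
    case (Int U V)
    then have "p \<in> U" "p \<in> V"
      by auto
    obtain k F where k: "k \<in> compact_elements L" "finite F" "F \<subseteq> compact_elements L" "k \<sqsubseteq> p"
        "\<forall>l\<in>F. \<not> l \<sqsubseteq> p" "\<forall>x\<in>carrier L. k \<sqsubseteq> x \<and> (\<forall>l\<in>F. \<not> l \<sqsubseteq> x) \<longrightarrow> x \<in> U"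
      using Int.IH(1)[OF \<open>p \<in> U\<close>] by metis
    obtain j G where j: "j \<in> compact_elements L" "finite G" "G \<subseteq> compact_elements L" "j \<sqsubseteq> p"
        "\<forall>l\<in>G. \<not> l \<sqsubseteq> p" "\<forall>x\<in>carrier L. j \<sqsubseteq> x \<and> (\<forall>l\<in>G. \<not> l \<sqsubseteq> x) \<longrightarrow> x \<in> V"
      using Int.IH(2)[OF \<open>p \<in> V\<close>] by metis
    have sub: "{k, j} \<subseteq> carrier L"
      using k j compact_elements_carrier by simp
    have le: "\<Squnion>{k, j} \<sqsubseteq> x \<longleftrightarrow> k \<sqsubseteq> x \<and> j \<sqsubseteq> x" if "x \<in> carrier L" for x
      using sup_le_iff[OF sub that] by simp
    show ?case
    proof (intro exI[of _ "\<Squnion>{k, j}"] exI[of _ "F \<union> G"] conjI ballI impI)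
      show "\<Squnion>{k, j} \<in> compact_elements L"
        using k j by (intro finite_sup_compact) auto
      show "\<Squnion>{k, j} \<sqsubseteq> p"
        using le[OF \<open>p \<in> carrier L\<close>] k j by simp
      fix x assume x: "x \<in> carrier L" "\<Squnion>{k, j} \<sqsubseteq> x \<and> (\<forall>l\<in>F \<union> G. \<not> l \<sqsubseteq> x)"
      then show "x \<in> U \<inter> V"
        using le[OF x(1)] k(6) j(6) by simp
    qed (use k j in auto)
  next
    case (Basis U)
    then consider (up) k where "k \<in> compact_elements L" "U = principal_up L k"
      | (down) l where "l \<in> compact_elements L" "U = carrier L - principal_up L l"
      by blast
    then show ?case
    proof cases
      case up
      then show ?thesis
        using Basis.prems by (intro exI[of _ k] exI[of _ "{}"]) (simp add: principal_up_def)
    next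
      case down
      then show ?thesis
        using Basis.prems bottom_compact \<open>p \<in> carrier L\<close>
        by (intro exI[of _ \<bottom>] exI[of _ "{l}"]) (simp add: principal_up_def)
    qed
  qed
qed

text \<open>
  By Alexander's subbase theorem it suffices to consider a cover by sets \<open>\<up>k\<close> and complements of
  \<open>\<up>l\<close>.  The join of all these \<open>l\<close> can only be covered by some \<open>\<up>k\<close>, and compactness of \<open>k\<close>
  yields finitely many \<open>l\<close> that suffice.
\<close>

lemma compact_space_lambda: "compact_space (lambda_topology L)"
proof -
  let ?\<B> = "{principal_up L k | k. k \<in> compact_elements L} \<union>
      {carrier L - principal_up L l | l. l \<in> compact_elements L}"
  show ?thesis
  proof (rule Alexander_subbase)
    show "topology (arbitrary union_of (finite intersection_of (\<lambda>x. x \<in> ?\<B>) relative_to \<Union>?\<B>))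
        = lambda_topology L"
      unfolding lambda_topology_def by (rule topology_generated_by_subbase)
    fix \<C> assume \<C>: "\<C> \<subseteq> ?\<B>" "\<Union>\<C> = topspace (lambda_topology L)"
    define N where "N = {l \<in> compact_elements L. carrier L - principal_up L l \<in> \<C>}"
    have Nc: "N \<subseteq> carrier L"
      using compact_elements_carrier by (auto simp: N_def)
    have supN: "\<Squnion>N \<in> carrier L"
      using Nc by simp
    then obtain U where U: "U \<in> \<C>" "\<Squnion>N \<in> U"
      using \<C> topspace_lambda by blast
    have "\<exists>k\<in>compact_elements L. U = principal_up L k"
    proof (rule ccontr)
      assume "\<not> ?thesis"
      then obtain l where l: "l \<in> compact_elements L" "U = carrier L - principal_up L l"
        using U \<C> by blast
      then have "l \<in> N"
        using U by (simp add: N_def)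
      then have "l \<sqsubseteq> \<Squnion>N"
        using sup_upper[OF Nc] by simp
      then show False
        using U(2) l(2) supN by (simp add: principal_up_def)
    qed
    then obtain k where k: "k \<in> compact_elements L" "U = principal_up L k"
      by blast
    then have "k \<sqsubseteq> \<Squnion>N"
      using U(2) by (simp add: principal_up_def)
    then obtain T where T: "T \<subseteq> N" "finite T" "k \<sqsubseteq> \<Squnion>T"
      using compact_elementsD[OF k(1) Nc] by blast
    have Tc: "T \<subseteq> carrier L"
      using T Nc by simp
    let ?\<F> = "insert U ((\<lambda>l. carrier L - principal_up L l) ` T)"
    have fin: "finite ?\<F>"
      using T by simp
    have sub: "?\<F> \<subseteq> \<C>"
      using T U by (auto simp: N_def)
    have "x \<in> \<Union>?\<F>" if x: "x \<in> carrier L" for x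
    proof (cases "\<forall>l\<in>T. l \<sqsubseteq> x")
      case True
      then have "\<Squnion>T \<sqsubseteq> x"
        using sup_le_iff[OF Tc x] by simp
      then have "k \<sqsubseteq> x"
        using le_trans[OF T(3)] k(1) compact_elements_carrier Tc x by simp
      then show ?thesis
        using k x by (simp add: principal_up_def)
    next
      case False
      then show ?thesis
        using x by (auto simp: principal_up_def)
    qed
    moreover have "\<Union>?\<F> \<subseteq> carrier L"
      using k by (auto simp: principal_up_def)
    ultimately have "\<Union>?\<F> = topspace (lambda_topology L)"
      unfolding topspace_lambda by blast
    then show "\<exists>\<C>'. finite \<C>' \<and> \<C>' \<subseteq> \<C> \<and> \<Union>\<C>' = topspace (lambda_topology L)"
      using fin sub by blast
  qed
qed

text \<open>
  Failure of pseudoprimeness of \<open>p\<close> is witnessed by finitely many compact elements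
  \<open>\<Sqinter>F \<sqsubseteq> k \<sqsubseteq> p\<close>, and the same elements witness it on a neighbourhood of \<open>p\<close>.
\<close>

lemma closedin_Y_carrier: "closedin (lambda_topology L) (Y_carrier L)"
proof -
  have "\<exists>T. openin (lambda_topology L) T \<and> p \<in> T \<and> T \<subseteq> carrier L - Y_carrier L"
    if p: "p \<in> carrier L - Y_carrier L" for p
  proof -
    have pc: "p \<in> carrier L" and "p \<noteq> \<top>" "p \<notin> pseudoprime_elements L"
      using p by (auto simp: Y_carrier_def)
    then obtain F k where F: "finite F" "F \<noteq> {}" "F \<subseteq> compact_elements L"
      and k: "k \<in> compact_elements L" "\<Sqinter>F \<sqsubseteq> k" "k \<sqsubseteq> p" and no: "\<not> (\<exists>f\<in>F. f \<sqsubseteq> p)"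
      using pseudoprime_elementsI[OF pc \<open>p \<noteq> \<top>\<close>] by metis
    have Fc: "F \<subseteq> carrier L"
      using F compact_elements_carrier by blast
    let ?T = "principal_up L k - \<Union>(principal_up L ` F)"
    have "openin (lambda_topology L) ?T"
      using F k openin_principal_up closedin_principal_up
      by (intro openin_diff closedin_Union) auto
    moreover have "p \<in> ?T"
      using k no pc by (simp add: principal_up_def)
    moreover have "x \<notin> Y_carrier L" if x: "x \<in> ?T" for x
    proof
      assume "x \<in> Y_carrier L"
      have xc: "x \<in> carrier L" "k \<sqsubseteq> x" "\<forall>f\<in>F. \<not> f \<sqsubseteq> x"
        using x by (auto simp: principal_up_def)
      obtain f where "f \<in> F"
        using F by blast
      then have "x \<noteq> \<top>"
        using xc Fc by auto
      then have "x \<in> pseudoprime_elements L"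
        using \<open>x \<in> Y_carrier L\<close> by (simp add: Y_carrier_def)
      then show False
        using pseudoprime_elementsD[OF _ F(1,2) Fc k(1,2) xc(2)] xc(3) by blast
    qed
    ultimately show ?thesis
      by (intro exI[of _ ?T]) (auto simp: principal_up_def)
  qed
  then have "openin (lambda_topology L) (carrier L - Y_carrier L)"
    by (subst openin_subopen) blast
  then show ?thesis
    using Y_carrier_subset by (simp add: closedin_def topspace_lambda)
qed

end


section \<open>The category of algebraic frames\<close>

lemma frm_homD:
  assumes "\<alpha> \<in> frm_hom L M"
  shows "algebraic_frame L" "algebraic_frame M" "\<alpha> \<in> carrier L \<rightarrow>\<^sub>E carrier M"
    "\<And>a. a \<in> carrier L \<Longrightarrow> \<alpha> a \<in> carrier M"
    "\<And>S. S \<subseteq> carrier L \<Longrightarrow> \<alpha> (\<Squnion>\<^bsub>L\<^esub>S) = \<Squnion>\<^bsub>M\<^esub>(\<alpha> ` S)"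
    "\<And>k. k \<in> compact_elements L \<Longrightarrow> \<alpha> k \<in> compact_elements M"
  using assms by (auto simp: frm_hom_def)

lemma frm_id_hom:
  assumes "algebraic_frame L" shows "frm_id L \<in> frm_hom L L"
proof -
  interpret algebraic_frame L by fact
  have "frm_id L \<in> carrier L \<rightarrow>\<^sub>E carrier L"
    by (simp add: frm_id_def)
  moreover have "frm_id L ` S = S" if "S \<subseteq> carrier L" for S
    using that by (auto simp: frm_id_def subset_iff image_def)
  ultimately show ?thesis
    using assms compact_elements_carrier by (simp add: frm_hom_def) (simp add: frm_id_def)
qed

lemma frm_comp_hom:
  assumes \<alpha>: "\<alpha> \<in> frm_hom L M" and \<beta>: "\<beta> \<in> frm_hom M N"
  shows "frm_comp L \<beta> \<alpha> \<in> frm_hom L N"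
proof -
  interpret L: algebraic_frame L by (rule frm_homD(1)[OF \<alpha>])
  have "frm_comp L \<beta> \<alpha> (\<Squnion>\<^bsub>L\<^esub>S) = \<Squnion>\<^bsub>N\<^esub>(frm_comp L \<beta> \<alpha> ` S)" if S: "S \<subseteq> carrier L" for S
  proof -
    have "\<alpha> ` S \<subseteq> carrier M"
      using S frm_homD(4)[OF \<alpha>] by blast
    moreover have "frm_comp L \<beta> \<alpha> ` S = \<beta> ` \<alpha> ` S"
      using S by (auto simp: frm_comp_def compose_def image_image subset_iff intro!: image_cong)
    ultimately show ?thesis
      using S by (simp add: frm_comp_def compose_def frm_homD(5)[OF \<alpha>] frm_homD(5)[OF \<beta>])
  qed
  moreover have "frm_comp L \<beta> \<alpha> k \<in> compact_elements N" if "k \<in> compact_elements L" for k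
    using that L.compact_elements_carrier[OF that]
    by (simp add: frm_comp_def compose_def frm_homD(6)[OF \<alpha>] frm_homD(6)[OF \<beta>])
  moreover have "frm_comp L \<beta> \<alpha> \<in> carrier L \<rightarrow>\<^sub>E carrier N"
    by (simp add: frm_comp_def compose_def frm_homD(4)[OF \<alpha>] frm_homD(4)[OF \<beta>])
  ultimately show ?thesis
    using frm_homD(1)[OF \<alpha>] frm_homD(2)[OF \<beta>] by (simp add: frm_hom_def)
qed

lemma frm_comp_id:
  assumes \<alpha>: "\<alpha> \<in> frm_hom L M"
  shows "frm_comp L \<alpha> (frm_id L) = \<alpha>" "frm_comp L (frm_id M) \<alpha> = \<alpha>"
  using frm_homD(3,4)[OF \<alpha>]
  by (auto simp: frm_comp_def frm_id_def compose_def restrict_def PiE_def extensional_def fun_eq_iff)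

lemma frm_comp_assoc:
  assumes \<alpha>: "\<alpha> \<in> frm_hom L M"
  shows "frm_comp L \<gamma> (frm_comp L \<beta> \<alpha>) = frm_comp L (frm_comp M \<gamma> \<beta>) \<alpha>"
  using frm_homD(4)[OF \<alpha>] by (auto simp: frm_comp_def compose_def restrict_def fun_eq_iff)

lemma frm_hom_mono:
  assumes \<alpha>: "\<alpha> \<in> frm_hom L M" and ab: "a \<in> carrier L" "b \<in> carrier L" "a \<sqsubseteq>\<^bsub>L\<^esub> b"
  shows "\<alpha> a \<sqsubseteq>\<^bsub>M\<^esub> \<alpha> b"
proof -
  interpret L: algebraic_frame L by (rule frm_homD(1)[OF \<alpha>])
  interpret M: algebraic_frame M by (rule frm_homD(2)[OF \<alpha>])
  have "\<Squnion>\<^bsub>L\<^esub>{a, b} = b"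
    using ab by (intro L.le_antisym L.sup_least L.sup_upper) auto
  then have "\<alpha> b = \<Squnion>\<^bsub>M\<^esub>{\<alpha> a, \<alpha> b}"
    using frm_homD(5)[OF \<alpha>, of "{a, b}"] ab by simp
  moreover have "\<alpha> a \<sqsubseteq>\<^bsub>M\<^esub> \<Squnion>\<^bsub>M\<^esub>{\<alpha> a, \<alpha> b}"
    using ab frm_homD(4)[OF \<alpha>] by (intro M.sup_upper) auto
  ultimately show ?thesis
    by simp
qed

text \<open>
  The map sending \<open>b\<close> to the join of all \<open>a\<close> with \<open>\<alpha> a \<sqsubseteq> b\<close> is an upper adjoint, because \<open>\<alpha>\<close>
  preserves this join.
\<close>

lemma right_adjoint_galois:
  assumes \<alpha>: "\<alpha> \<in> frm_hom L M"
  shows "galois_connection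
    \<lparr>orderA = L, orderB = M, lower = \<alpha>, upper = right_adjoint L M \<alpha>\<rparr>"
proof -
  interpret L: algebraic_frame L by (rule frm_homD(1)[OF \<alpha>])
  interpret M: algebraic_frame M by (rule frm_homD(2)[OF \<alpha>])
  define r where "r b = \<Squnion>\<^bsub>L\<^esub>{a \<in> carrier L. \<alpha> a \<sqsubseteq>\<^bsub>M\<^esub> b}" for b
  have "galois_connection \<lparr>orderA = L, orderB = M, lower = \<alpha>, upper = r\<rparr>"
  proof (intro galois_connection.intro connection.intro galois_connection_axioms.intro, simp_all)
    show "partial_order L" "partial_order M"
      by (rule L.partial_order_axioms M.partial_order_axioms)+
    show "\<alpha> \<in> carrier L \<rightarrow> carrier M"
      using frm_homD(4)[OF \<alpha>] by blast
    show "r \<in> carrier M \<rightarrow> carrier L"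
      by (auto simp: r_def)
    fix a b assume ab: "a \<in> carrier L" "b \<in> carrier M"
    show "\<alpha> a \<sqsubseteq>\<^bsub>M\<^esub> b \<longleftrightarrow> a \<sqsubseteq>\<^bsub>L\<^esub> r b"
    proof
      assume "\<alpha> a \<sqsubseteq>\<^bsub>M\<^esub> b"
      then show "a \<sqsubseteq>\<^bsub>L\<^esub> r b"
        unfolding r_def using ab by (intro L.sup_upper) auto
    next
      assume a: "a \<sqsubseteq>\<^bsub>L\<^esub> r b"
      have rb: "r b \<in> carrier L"
        by (auto simp: r_def)
      have "\<alpha> (r b) = \<Squnion>\<^bsub>M\<^esub>(\<alpha> ` {a \<in> carrier L. \<alpha> a \<sqsubseteq>\<^bsub>M\<^esub> b})"
        unfolding r_def by (rule frm_homD(5)[OF \<alpha>]) auto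
      also have "\<dots> \<sqsubseteq>\<^bsub>M\<^esub> b"
        using ab frm_homD(4)[OF \<alpha>] by (intro M.sup_least) auto
      finally have "\<alpha> (r b) \<sqsubseteq>\<^bsub>M\<^esub> b" .
      then show "\<alpha> a \<sqsubseteq>\<^bsub>M\<^esub> b"
        using M.le_trans[OF frm_hom_mono[OF \<alpha> ab(1) rb a]] ab rb frm_homD(4)[OF \<alpha>] by simp
    qed
  qed
  then show ?thesis
    unfolding right_adjoint_def
    by (rule someI[of "\<lambda>r. galois_connection \<lparr>orderA = L, orderB = M, lower = \<alpha>, upper = r\<rparr>"])
qed

lemma right_adjoint_closed:
  assumes "\<alpha> \<in> frm_hom L M" "b \<in> carrier M"
  shows "right_adjoint L M \<alpha> b \<in> carrier L"
  using connection.upper_closed[OF galois_connection.axioms(1)[OF right_adjoint_galois[OF assms(1)]]]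
    assms(2) by simp

lemma right_adjoint_iff:
  assumes "\<alpha> \<in> frm_hom L M" "a \<in> carrier L" "b \<in> carrier M"
  shows "a \<sqsubseteq>\<^bsub>L\<^esub> right_adjoint L M \<alpha> b \<longleftrightarrow> \<alpha> a \<sqsubseteq>\<^bsub>M\<^esub> b"
  using galois_connection.galois_property[OF right_adjoint_galois[OF assms(1)]] assms(2,3) by simp

lemma order_iso_frm_hom:
  assumes L: "algebraic_frame L" and M: "algebraic_frame M"
    and ext: "\<alpha> \<in> carrier L \<rightarrow>\<^sub>E carrier M" and bij: "bij_betw \<alpha> (carrier L) (carrier M)"
    and le: "\<And>x y. \<lbrakk>x \<in> carrier L; y \<in> carrier L\<rbrakk> \<Longrightarrow> \<alpha> x \<sqsubseteq>\<^bsub>M\<^esub> \<alpha> y \<longleftrightarrow> x \<sqsubseteq>\<^bsub>L\<^esub> y"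
  shows "\<alpha> \<in> frm_hom L M"
proof -
  interpret L: algebraic_frame L by (rule L)
  interpret M: algebraic_frame M by (rule M)
  have cl: "\<And>a. a \<in> carrier L \<Longrightarrow> \<alpha> a \<in> carrier M"
    using ext by auto
  have im: "\<alpha> ` carrier L = carrier M"
    using bij by (simp add: bij_betw_def)
  have sup: "\<alpha> (\<Squnion>\<^bsub>L\<^esub>S) = \<Squnion>\<^bsub>M\<^esub>(\<alpha> ` S)" if S: "S \<subseteq> carrier L" for S
  proof (rule M.le_antisym)
    have \<alpha>S: "\<alpha> ` S \<subseteq> carrier M"
      using S cl by blast
    show closed: "\<alpha> (\<Squnion>\<^bsub>L\<^esub>S) \<in> carrier M" "\<Squnion>\<^bsub>M\<^esub>(\<alpha> ` S) \<in> carrier M"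
      using S cl \<alpha>S by auto
    show "\<Squnion>\<^bsub>M\<^esub>(\<alpha> ` S) \<sqsubseteq>\<^bsub>M\<^esub> \<alpha> (\<Squnion>\<^bsub>L\<^esub>S)"
    proof (rule M.sup_least[OF \<alpha>S closed(1)])
      fix x assume "x \<in> \<alpha> ` S"
      then obtain s where s: "s \<in> S" "x = \<alpha> s"
        by blast
      then show "x \<sqsubseteq>\<^bsub>M\<^esub> \<alpha> (\<Squnion>\<^bsub>L\<^esub>S)"
        using le[of s "\<Squnion>\<^bsub>L\<^esub>S"] S L.sup_upper[OF S s(1)] by auto
    qed
    have "\<Squnion>\<^bsub>M\<^esub>(\<alpha> ` S) \<in> \<alpha> ` carrier L"
      using closed im by simp
    then obtain y where y: "y \<in> carrier L" "\<Squnion>\<^bsub>M\<^esub>(\<alpha> ` S) = \<alpha> y"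
      by blast
    have "\<Squnion>\<^bsub>L\<^esub>S \<sqsubseteq>\<^bsub>L\<^esub> y"
    proof (rule L.sup_least[OF S y(1)])
      fix s assume s: "s \<in> S"
      then have "\<alpha> s \<sqsubseteq>\<^bsub>M\<^esub> \<alpha> y"
        unfolding y(2)[symmetric] by (intro M.sup_upper[OF \<alpha>S]) auto
      then show "s \<sqsubseteq>\<^bsub>L\<^esub> y"
        using le[of s y] s S y by auto
    qed
    then show "\<alpha> (\<Squnion>\<^bsub>L\<^esub>S) \<sqsubseteq>\<^bsub>M\<^esub> \<Squnion>\<^bsub>M\<^esub>(\<alpha> ` S)"
      using le[of "\<Squnion>\<^bsub>L\<^esub>S" y] S y by simp
  qed
  have "\<alpha> k \<in> compact_elements M" if k: "k \<in> compact_elements L" for k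
    unfolding compact_elements_def
  proof (intro CollectI conjI allI impI)
    have kc: "k \<in> carrier L"
      using k by (rule L.compact_elements_carrier)
    then show "\<alpha> k \<in> carrier M"
      by (rule cl)
    fix S assume S: "S \<subseteq> carrier M" "\<alpha> k \<sqsubseteq>\<^bsub>M\<^esub> \<Squnion>\<^bsub>M\<^esub>S"
    define S' where "S' = {a \<in> carrier L. \<alpha> a \<in> S}"
    have S': "S' \<subseteq> carrier L" "\<alpha> ` S' = S"
      using S(1) im by (auto simp: S'_def)
    have "\<alpha> k \<sqsubseteq>\<^bsub>M\<^esub> \<alpha> (\<Squnion>\<^bsub>L\<^esub>S')"
      using S sup[OF S'(1)] S'(2) by simp
    then have "k \<sqsubseteq>\<^bsub>L\<^esub> \<Squnion>\<^bsub>L\<^esub>S'"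
      using le[of k "\<Squnion>\<^bsub>L\<^esub>S'"] kc S' by simp
    then obtain T where T: "T \<subseteq> S'" "finite T" "k \<sqsubseteq>\<^bsub>L\<^esub> \<Squnion>\<^bsub>L\<^esub>T"
      using L.compact_elementsD[OF k S'(1)] by blast
    have Tc: "T \<subseteq> carrier L"
      using T S' by blast
    have "\<alpha> k \<sqsubseteq>\<^bsub>M\<^esub> \<Squnion>\<^bsub>M\<^esub>(\<alpha> ` T)"
      using le[of k "\<Squnion>\<^bsub>L\<^esub>T"] kc Tc T(3) sup[OF Tc] by simp
    moreover have "\<alpha> ` T \<subseteq> S"
      using T S' by blast
    ultimately show "\<exists>T\<subseteq>S. finite T \<and> \<alpha> k \<sqsubseteq>\<^bsub>M\<^esub> \<Squnion>\<^bsub>M\<^esub>T"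
      using T(2) by (intro exI[of _ "\<alpha> ` T"]) simp
  qed
  then show ?thesis
    using L M ext sup by (simp add: frm_hom_def)
qed

lemma order_iso_frm_iso:
  assumes L: "algebraic_frame L" and M: "algebraic_frame M"
    and ext: "\<alpha> \<in> carrier L \<rightarrow>\<^sub>E carrier M" and bij: "bij_betw \<alpha> (carrier L) (carrier M)"
    and le: "\<And>x y. \<lbrakk>x \<in> carrier L; y \<in> carrier L\<rbrakk> \<Longrightarrow> \<alpha> x \<sqsubseteq>\<^bsub>M\<^esub> \<alpha> y \<longleftrightarrow> x \<sqsubseteq>\<^bsub>L\<^esub> y"
  shows "\<alpha> \<in> frm_iso L M"
proof -
  define \<beta> where "\<beta> = (\<lambda>b\<in>carrier M. inv_into (carrier L) \<alpha> b)"
  have \<beta>\<alpha>: "\<beta> (\<alpha> a) = a" if "a \<in> carrier L" for a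
    using that bij ext by (auto simp: \<beta>_def bij_betw_def)
  have \<alpha>\<beta>: "\<alpha> (\<beta> b) = b" "\<beta> b \<in> carrier L" if "b \<in> carrier M" for b
    using that bij by (auto simp: \<beta>_def bij_betw_def f_inv_into_f inv_into_into)
  have \<alpha>_closed: "\<alpha> a \<in> carrier M" if "a \<in> carrier L" for a
    using that ext by auto
  have "\<beta> \<in> frm_hom M L"
  proof (rule order_iso_frm_hom[OF M L])
    show "\<beta> \<in> carrier M \<rightarrow>\<^sub>E carrier L"
      using \<alpha>\<beta>(2) by (auto simp: \<beta>_def)
    show "bij_betw \<beta> (carrier M) (carrier L)"
      using \<alpha>\<beta> \<beta>\<alpha> \<alpha>_closed by (intro bij_betwI[of _ _ _ \<alpha>]) auto
    show "\<beta> x \<sqsubseteq>\<^bsub>L\<^esub> \<beta> y \<longleftrightarrow> x \<sqsubseteq>\<^bsub>M\<^esub> y" if "x \<in> carrier M" "y \<in> carrier M" for x y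
      using le[of "\<beta> x" "\<beta> y"] that \<alpha>\<beta> by simp
  qed
  moreover have "frm_comp L \<beta> \<alpha> = frm_id L" "frm_comp M \<alpha> \<beta> = frm_id M"
    using \<beta>\<alpha> \<alpha>\<beta> by (auto simp: frm_comp_def frm_id_def compose_def restrict_def fun_eq_iff)
  ultimately show ?thesis
    using order_iso_frm_hom[OF assms] unfolding frm_iso_def by blast
qed


section \<open>Priestley spaces\<close>

lemma compact_space_Inter_subset_open:
  assumes cpt: "compact_space T" and cl: "\<And>C. C \<in> \<C> \<Longrightarrow> closedin T C"
    and U: "openin T U" "topspace T \<inter> \<Inter>\<C> \<subseteq> U"
  shows "\<exists>\<F>\<subseteq>\<C>. finite \<F> \<and> topspace T \<inter> \<Inter>\<F> \<subseteq> U"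
proof -
  have "compactin T (topspace T - U)"
    using cpt U by (intro closedin_compact_space closedin_diff) auto
  moreover have "\<And>V. V \<in> (\<lambda>C. topspace T - C) ` \<C> \<Longrightarrow> openin T V"
    using cl by (auto simp: closedin_def)
  moreover have "topspace T - U \<subseteq> \<Union>((\<lambda>C. topspace T - C) ` \<C>)"
    using U by blast
  ultimately obtain \<G> where \<G>: "finite \<G>" "\<G> \<subseteq> (\<lambda>C. topspace T - C) ` \<C>" "topspace T - U \<subseteq> \<Union>\<G>"
    using compactinD[of T "topspace T - U" "(\<lambda>C. topspace T - C) ` \<C>"] by metis
  then obtain \<F> where \<F>: "\<F> \<subseteq> \<C>" "finite \<F>" "\<G> = (\<lambda>C. topspace T - C) ` \<F>"
    using finite_subset_image[OF \<G>(1,2)] by metis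
  have "topspace T \<inter> \<Inter>\<F> \<subseteq> U"
    using \<G>(3) \<F>(3) by blast
  then show ?thesis
    using \<F> by blast
qed

lemma clopen_upsetD:
  assumes "clopen_upset X U"
  shows "openin (topo X) U" "closedin (topo X) U" "upset X U" "U \<subseteq> carrier X"
  using assms by (auto simp: clopen_upset_def upset_def)

lemma upsetD: "\<lbrakk>upset X U; x \<in> U; y \<in> carrier X; x \<sqsubseteq>\<^bsub>X\<^esub> y\<rbrakk> \<Longrightarrow> y \<in> U"
  by (simp add: upset_def)

lemma adm_clopenD: "U \<in> adm_clopen X \<Longrightarrow> clopen_upset X U"
  by (simp add: adm_clopen_def)

lemma adm_closedD:
  assumes "C \<in> adm_closed X"
  shows "closedin (topo X) C" "upset X C" "C \<subseteq> carrier X"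
    "carrier X - C = down_closure X (dist_pts X - C)"
  using assms by (auto simp: adm_closed_def upset_def)

context priestley_space
begin

lemma clopen_upset_carrier: "clopen_upset X (carrier X)"
  using openin_topspace[of "topo X"] closedin_topspace[of "topo X"]
  by (simp add: clopen_upset_def upset_def topspace_topo)

lemma closedin_principal_up_pt:
  assumes x: "x \<in> carrier X"
  shows "closedin (topo X) (principal_up X x)"
proof -
  have "principal_up X x = \<Inter>{U. clopen_upset X U \<and> x \<in> U}"
  proof (intro equalityI subsetI InterI)
    fix y U assume "y \<in> principal_up X x" "U \<in> {U. clopen_upset X U \<and> x \<in> U}"
    then show "y \<in> U"
      using upsetD[OF clopen_upsetD(3)] by (auto simp: principal_up_def)
  next
    fix y assume y: "y \<in> \<Inter>{U. clopen_upset X U \<and> x \<in> U}"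
    then have "y \<in> carrier X"
      using clopen_upset_carrier x by blast
    moreover have "x \<sqsubseteq> y"
      using separation[OF x calculation] y by blast
    ultimately show "y \<in> principal_up X x"
      by (simp add: principal_up_def)
  qed
  moreover have "closedin (topo X) (\<Inter>{U. clopen_upset X U \<and> x \<in> U})"
    using clopen_upset_carrier x clopen_upsetD(2) by (intro closedin_Inter) auto
  ultimately show ?thesis
    by simp
qed

text \<open>
  A chain in a closed set has an upper bound in it: the principal upsets of its members are closed
  and finitely many of them have a common point in the set, namely the largest generator.
\<close>

lemma below_maximal_point:
  assumes D: "closedin (topo X) D" and x: "x \<in> D"
  shows "\<exists>y \<in> maximal_points X D. x \<sqsubseteq> y"
proof -
  have Dc: "D \<subseteq> carrier X"
    using closedin_subset[OF D] topspace_topo by simp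
  define A where "A = {y \<in> D. x \<sqsubseteq> y}"
  have Ac: "A \<subseteq> carrier X" and xA: "x \<in> A"
    using Dc x by (auto simp: A_def)
  have "\<exists>m\<in>A. \<forall>a\<in>A. m \<sqsubseteq> a \<longrightarrow> a = m"
  proof (rule predicate_Zorn)
    show "partial_order_on A (relation_of (\<sqsubseteq>) A)"
      using Ac by (intro partial_order_on_relation_ofI) (auto intro: le_trans le_antisym)
    fix C assume C: "C \<in> Chains (relation_of (\<sqsubseteq>) A)"
    then have CA: "C \<subseteq> A" and tot: "\<And>x y. x \<in> C \<Longrightarrow> y \<in> C \<Longrightarrow> x \<sqsubseteq> y \<or> y \<sqsubseteq> x"
      unfolding Chains_def relation_of_def by auto
    have Cc: "C \<subseteq> carrier X"
      using CA Ac by blast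
    show "\<exists>u\<in>A. \<forall>a\<in>C. a \<sqsubseteq> u"
    proof (cases "C = {}")
      case True
      then show ?thesis using xA by blast
    next
      case False
      have "D \<inter> \<Inter>(principal_up X ` C) \<noteq> {}"
      proof
        assume "D \<inter> \<Inter>(principal_up X ` C) = {}"
        then have "topspace (topo X) \<inter> \<Inter>(principal_up X ` C) \<subseteq> topspace (topo X) - D"
          by blast
        moreover have "openin (topo X) (topspace (topo X) - D)"
          using D by blast
        moreover have "\<And>E. E \<in> principal_up X ` C \<Longrightarrow> closedin (topo X) E"
          using closedin_principal_up_pt Cc by blast
        ultimately obtain \<F> where \<F>: "\<F> \<subseteq> principal_up X ` C" "finite \<F>"
            "topspace (topo X) \<inter> \<Inter>\<F> \<subseteq> topspace (topo X) - D"
          using compact_space_Inter_subset_open[OF compact_topo] by metis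
        obtain T where T: "T \<subseteq> C" "finite T" "\<F> = principal_up X ` T"
          using finite_subset_image[OF \<F>(2,1)] by metis
        obtain u where u: "u \<in> C" "\<forall>t\<in>T. t \<sqsubseteq> u"
          using chain_finite_upper_bound[OF Cc False tot T(2,1)] by blast
        have "u \<in> carrier X"
          using u Cc by blast
        then have "u \<in> topspace (topo X) \<inter> \<Inter>\<F>"
          using u T(3) by (simp add: topspace_topo principal_up_def)
        then have "u \<notin> D"
          using \<F>(3) by blast
        then show False
          using u CA by (auto simp: A_def)
      qed
      then obtain u where u: "u \<in> D" "\<And>c. c \<in> C \<Longrightarrow> u \<in> principal_up X c"
        by blast
      obtain c where c: "c \<in> C"
        using False by blast
      have "x \<sqsubseteq> u"
        using le_trans[of x c u] c CA u Dc x by (auto simp: A_def principal_up_def subset_iff)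
      then show ?thesis
        using u by (intro bexI[of _ u]) (auto simp: A_def principal_up_def)
    qed
  qed
  then obtain m where m: "m \<in> A" "\<And>a. a \<in> A \<Longrightarrow> m \<sqsubseteq> a \<Longrightarrow> a = m"
    by blast
  have "y = m" if y: "y \<in> D" "m \<sqsubseteq> y" for y
  proof -
    have "x \<sqsubseteq> y"
      using le_trans[of x m y] m(1) y Dc x by (auto simp: A_def subset_iff)
    then show ?thesis
      using m(2) y by (simp add: A_def)
  qed
  then have "m \<in> maximal_points X D"
    using m(1) by (auto simp: maximal_points_def A_def)
  then show ?thesis
    using m(1) by (auto simp: A_def)
qed

text \<open>
  The complement of a clopen upset is closed, so each of its points lies below a maximal one; these
  are in \<open>X\<^sub>0\<close> by admissibility.  Conversely a maximal point of \<open>\<down>(X\<^sub>0 - U)\<close> is itself in \<open>X\<^sub>0\<close>.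
\<close>

lemma adm_clopen_iff_open_adm_closed:
  assumes dist: "dist_pts X \<subseteq> carrier X"
  shows "U \<in> adm_clopen X \<longleftrightarrow> U \<in> adm_closed X \<and> openin (topo X) U"
proof
  assume U: "U \<in> adm_clopen X"
  note cu = clopen_upsetD[OF adm_clopenD[OF U]]
  have "carrier X - U \<subseteq> down_closure X (dist_pts X - U)"
  proof
    fix x assume x: "x \<in> carrier X - U"
    have "closedin (topo X) (carrier X - U)"
      using cu(1) topspace_topo by (metis closedin_diff closedin_topspace)
    then obtain y where y: "y \<in> maximal_points X (carrier X - U)" "x \<sqsubseteq> y"
      using below_maximal_point[OF _ x] by blast
    then have "y \<in> dist_pts X - U"
      using U by (auto simp: adm_clopen_def maximal_points_def)
    then show "x \<in> down_closure X (dist_pts X - U)"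
      using x y by (auto simp: down_closure_def)
  qed
  moreover have "down_closure X (dist_pts X - U) \<subseteq> carrier X - U"
    using upsetD[OF cu(3)] dist by (auto simp: down_closure_def)
  ultimately show "U \<in> adm_closed X \<and> openin (topo X) U"
    using cu by (simp add: adm_closed_def)
next
  assume U: "U \<in> adm_closed X \<and> openin (topo X) U"
  have "maximal_points X (carrier X - U) \<subseteq> dist_pts X"
  proof
    fix x assume x: "x \<in> maximal_points X (carrier X - U)"
    then have "x \<in> down_closure X (dist_pts X - U)"
      using U adm_closedD(4) by (auto simp: maximal_points_def)
    then obtain y where y: "y \<in> dist_pts X" "y \<notin> U" "x \<sqsubseteq> y"
      by (auto simp: down_closure_def)
    then have "y = x"
      using x dist by (auto simp: maximal_points_def)
    then show "x \<in> dist_pts X"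
      using y by simp
  qed
  then show "U \<in> adm_clopen X"
    using U adm_closedD by (auto simp: adm_clopen_def clopen_upset_def)
qed

end


section \<open>Admissible closed upsets of pointed generalized Priestley spaces\<close>

context pointed_gen_priestley_space
begin

lemma dist_pts_carrier: "dist_pts X \<subseteq> carrier X"
  using dist_pts_subset by blast

lemmas adm_clopen_iff = adm_clopen_iff_open_adm_closed[OF dist_pts_carrier]

lemma adm_clopen_closed: "U \<in> adm_clopen X \<Longrightarrow> U \<in> adm_closed X"
  by (simp add: adm_clopen_iff)

lemma adm_closed_Inter:
  assumes "\<C> \<subseteq> adm_closed X"
  shows "carrier X \<inter> \<Inter>\<C> \<in> adm_closed X"
proof -
  have "closedin (topo X) (carrier X \<inter> \<Inter>\<C>)"
  proof (cases "\<C> = {}")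
    case True
    then show ?thesis
      using clopen_upsetD(2)[OF clopen_upset_carrier] by simp
  next
    case False
    then show ?thesis
      using assms adm_closedD(1) clopen_upsetD(2)[OF clopen_upset_carrier]
      by (intro closedin_Int closedin_Inter) auto
  qed
  moreover have "upset X (carrier X \<inter> \<Inter>\<C>)"
    unfolding upset_def
  proof (intro conjI ballI impI)
    fix x y assume xy: "x \<in> carrier X \<inter> \<Inter>\<C>" "y \<in> carrier X" "x \<sqsubseteq> y"
    have "y \<in> C" if "C \<in> \<C>" for C
      using upsetD[OF adm_closedD(2)[of C X], of x y] that assms xy by auto
    then show "y \<in> carrier X \<inter> \<Inter>\<C>"
      using xy by blast
  qed blast
  moreover have "carrier X - carrier X \<inter> \<Inter>\<C> = down_closure X (dist_pts X - carrier X \<inter> \<Inter>\<C>)"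
    (is "?l = ?r")
  proof (intro equalityI subsetI)
    fix x assume "x \<in> ?l"
    then obtain C where C: "C \<in> \<C>" "x \<in> carrier X - C"
      by blast
    then have "x \<in> down_closure X (dist_pts X - C)"
      using adm_closedD(4)[of C X] assms by auto
    then show "x \<in> ?r"
      using C(1) by (auto simp: down_closure_def)
  next
    fix x assume "x \<in> ?r"
    then obtain y C where y: "x \<in> carrier X" "y \<in> dist_pts X" "x \<sqsubseteq> y" "C \<in> \<C>" "y \<notin> C"
      using dist_pts_carrier by (auto simp: down_closure_def)
    then have "x \<in> down_closure X (dist_pts X - C)"
      by (auto simp: down_closure_def)
    then have "x \<in> carrier X - C"
      using adm_closedD(4)[of C X] assms y(4) by auto
    then show "x \<in> ?l"
      using y(4) by blast
  qed
  ultimately show ?thesis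
    by (simp add: adm_closed_def)
qed

lemma carrier_adm_clopen: "carrier X \<in> adm_clopen X"
  using clopen_upset_carrier by (simp add: adm_clopen_def maximal_points_def)

lemma max_pt_in_adm_clopen:
  assumes "U \<in> adm_clopen X"
  shows "max_pt X \<in> U"
proof (rule ccontr)
  assume no: "max_pt X \<notin> U"
  have m: "max_pt X \<in> carrier X" "\<forall>x\<in>carrier X. x \<sqsubseteq> max_pt X"
    using max_pt_greatest by (auto simp: greatest_def)
  have "max_pt X \<in> maximal_points X (carrier X - U)"
    using no m by (auto simp: maximal_points_def intro: le_antisym)
  then show False
    using assms dist_pts_subset by (auto simp: adm_clopen_def)
qed

lemma adm_clopen_finite_Inter:
  assumes "finite \<F>" "\<F> \<subseteq> adm_clopen X"
  shows "carrier X \<inter> \<Inter>\<F> \<in> adm_clopen X"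
proof -
  have "openin (topo X) (carrier X \<inter> \<Inter>\<F>)"
    using assms clopen_upsetD(1)[OF clopen_upset_carrier] clopen_upsetD(1)[OF adm_clopenD]
    by (intro openin_Int_Inter) auto
  moreover have "\<F> \<subseteq> adm_closed X"
    using assms(2) adm_clopen_closed by blast
  ultimately show ?thesis
    using adm_closed_Inter[of \<F>] by (simp add: adm_clopen_iff)
qed

lemma adm_missing_finite_Union:
  assumes y: "y \<in> dist_pts X" and "finite \<F>" "\<F> \<subseteq> adm_missing X y"
  shows "\<exists>W\<in>adm_missing X y. \<Union>\<F> \<subseteq> W"
proof -
  have yc: "y \<in> carrier X"
    using y dist_pts_carrier by blast
  have dir: "adm_missing X y \<noteq> {}" "directed_family (adm_missing X y)"
    using dist_pts_iff[OF yc] y by simp_all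
  show ?thesis
    using assms(2,3)
  proof (induction \<F>)
    case empty
    then show ?case
      using dir(1) by auto
  next
    case (insert U \<F>)
    then obtain W where W: "W \<in> adm_missing X y" "\<Union>\<F> \<subseteq> W"
      by auto
    have "U \<in> adm_missing X y"
      using insert.prems by simp
    then obtain W' where "W' \<in> adm_missing X y" "U \<subseteq> W'" "W \<subseteq> W'"
      using bspec[OF bspec[OF dir(2)[unfolded directed_family_def]] W(1)] by metis
    then show ?case
      using W(2) by (intro bexI[of _ W']) auto
  qed
qed

text \<open>
  A closed upset missing a point of \<open>X\<^sub>0\<close> is covered by admissible clopen upsets missing that
  point, hence by finitely many, hence, as these form a directed family, by a single one.
\<close>

lemma adm_clopen_separates_dist_pt:
  assumes C: "closedin (topo X) C" "upset X C" and y: "y \<in> dist_pts X" "y \<notin> C"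
  shows "\<exists>U\<in>adm_missing X y. C \<subseteq> U"
proof -
  have yc: "y \<in> carrier X"
    using y dist_pts_carrier by blast
  have "C \<subseteq> \<Union>(adm_missing X y)"
  proof
    fix c assume c: "c \<in> C"
    then have cc: "c \<in> carrier X"
      using C(2) by (auto simp: upset_def)
    have "\<not> c \<sqsubseteq> y"
      using upsetD[OF C(2) c yc] y by blast
    then obtain U where "U \<in> adm_clopen X" "c \<in> U" "y \<notin> U"
      using le_iff_adm[OF cc yc] by blast
    then show "c \<in> \<Union>(adm_missing X y)"
      by (auto simp: adm_missing_def)
  qed
  then have "\<exists>\<F>. finite \<F> \<and> \<F> \<subseteq> adm_missing X y \<and> C \<subseteq> \<Union>\<F>"
    by (intro compactinD[OF closedin_compact_space[OF compact_topo C(1)]])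
       (simp_all add: adm_missing_def clopen_upsetD(1)[OF adm_clopenD])
  then obtain \<F> where \<F>: "finite \<F>" "\<F> \<subseteq> adm_missing X y" "C \<subseteq> \<Union>\<F>"
    by (elim exE conjE)
  show ?thesis
    using adm_missing_finite_Union[OF y(1) \<F>(1,2)] \<F>(3) by (meson subset_trans)
qed

lemma adm_closed_separates:
  assumes C: "C \<in> adm_closed X" and x: "x \<in> carrier X" "x \<notin> C"
  shows "\<exists>U\<in>adm_clopen X. C \<subseteq> U \<and> x \<notin> U"
proof -
  have "x \<in> down_closure X (dist_pts X - C)"
    using adm_closedD(4)[OF C] x by blast
  then obtain y where y: "y \<in> dist_pts X" "y \<notin> C" "x \<sqsubseteq> y"
    by (auto simp: down_closure_def)
  obtain U where U: "U \<in> adm_missing X y" "C \<subseteq> U"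
    using adm_clopen_separates_dist_pt[OF adm_closedD(1,2)[OF C] y(1,2)] by (elim bexE)
  then have "x \<notin> U"
    using upsetD[OF clopen_upsetD(3)[OF adm_clopenD], of U X x y] y dist_pts_carrier
    by (auto simp: adm_missing_def)
  then show ?thesis
    using U by (auto simp: adm_missing_def)
qed

lemma adm_closed_eq_Inter:
  assumes C: "C \<in> adm_closed X"
  shows "C = carrier X \<inter> \<Inter>{U \<in> adm_clopen X. C \<subseteq> U}"
proof (intro equalityI subsetI)
  fix x assume "x \<in> C"
  then show "x \<in> carrier X \<inter> \<Inter>{U \<in> adm_clopen X. C \<subseteq> U}"
    using adm_closedD(3)[OF C] by auto
next
  fix x assume x: "x \<in> carrier X \<inter> \<Inter>{U \<in> adm_clopen X. C \<subseteq> U}"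
  show "x \<in> C"
  proof (rule ccontr)
    assume "x \<notin> C"
    obtain U where "U \<in> adm_clopen X" "C \<subseteq> U" "x \<notin> U"
      using adm_closed_separates[OF C IntD1[OF x] \<open>x \<notin> C\<close>] by (elim bexE conjE)
    then show False
      using x by simp
  qed
qed

lemma adm_closed_subset_iff_trace:
  assumes C: "C \<in> adm_closed X" and D: "D \<in> adm_closed X"
  shows "C \<subseteq> D \<longleftrightarrow> dist_pts X \<inter> C \<subseteq> dist_pts X \<inter> D"
proof
  assume "dist_pts X \<inter> C \<subseteq> dist_pts X \<inter> D"
  then have "down_closure X (dist_pts X - D) \<subseteq> down_closure X (dist_pts X - C)"
    by (auto simp: down_closure_def)
  then have "carrier X - D \<subseteq> carrier X - C"
    using adm_closedD(4)[OF C] adm_closedD(4)[OF D] by simp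
  then show "C \<subseteq> D"
    using adm_closedD(3)[OF C] by blast
qed blast


section \<open>The frame of admissible closed upsets\<close>

lemma principal_up_adm_closed:
  assumes x: "x \<in> carrier X"
  shows "principal_up X x \<in> adm_closed X"
proof -
  have "principal_up X x = carrier X \<inter> \<Inter>{U \<in> adm_clopen X. x \<in> U}"
    using le_iff_adm[OF x] by (auto simp: principal_up_def)
  moreover have "{U \<in> adm_clopen X. x \<in> U} \<subseteq> adm_closed X"
    using adm_clopen_closed by blast
  ultimately show ?thesis
    using adm_closed_Inter by simp
qed

end

lemma V_ob_simps [simp]:
  "carrier (V_ob X) = adm_closed X" "eq (V_ob X) = (=)" "C \<sqsubseteq>\<^bsub>V_ob X\<^esub> D \<longleftrightarrow> D \<subseteq> C"
  by (simp_all add: V_ob_def)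

context pointed_gen_priestley_space
begin

lemma V_ob_complete_lattice: "complete_lattice (V_ob X)"
proof -
  interpret V: partial_order "V_ob X"
    by unfold_locales auto
  show ?thesis
  proof (rule V.complete_latticeI)
    fix \<C> assume "\<C> \<subseteq> carrier (V_ob X)"
    then have \<C>: "\<C> \<subseteq> adm_closed X"
      by simp
    have "least (V_ob X) (carrier X \<inter> \<Inter>\<C>) (Upper (V_ob X) \<C>)"
      using \<C> adm_closed_Inter[OF \<C>] adm_closedD(3)[where X=X]
      by (intro least_UpperI) (auto simp: Upper_def)
    then show "\<exists>s. least (V_ob X) s (Upper (V_ob X) \<C>)"
      by blast
    let ?\<D> = "{D \<in> adm_closed X. \<Union>\<C> \<subseteq> D}"
    have "\<Union>\<C> \<subseteq> D" "D \<in> adm_closed X" if "D \<in> Lower (V_ob X) \<C>" for D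
      using that \<C> by (auto simp: Lower_def subset_iff)
    then have "greatest (V_ob X) (carrier X \<inter> \<Inter>?\<D>) (Lower (V_ob X) \<C>)"
      using \<C> adm_closed_Inter[of ?\<D>] adm_closedD(3)[where X=X]
      by (intro greatest_LowerI) (simp_all, blast+)
    then show "\<exists>i. greatest (V_ob X) i (Lower (V_ob X) \<C>)"
      by blast
  qed
qed

lemma V_ob_sup:
  assumes \<C>: "\<C> \<subseteq> adm_closed X"
  shows "\<Squnion>\<^bsub>V_ob X\<^esub>\<C> = carrier X \<inter> \<Inter>\<C>"
proof -
  interpret V: complete_lattice "V_ob X" by (rule V_ob_complete_lattice)
  have \<C>': "\<C> \<subseteq> carrier (V_ob X)" and cl: "carrier X \<inter> \<Inter>\<C> \<in> carrier (V_ob X)"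
    using \<C> adm_closed_Inter[OF \<C>] by auto
  show ?thesis
  proof (rule equalityI)
    show "\<Squnion>\<^bsub>V_ob X\<^esub>\<C> \<subseteq> carrier X \<inter> \<Inter>\<C>"
      using V.sup_upper[OF \<C>'] V.sup_closed[OF \<C>'] adm_closedD(3)[where X=X] by auto
    show "carrier X \<inter> \<Inter>\<C> \<subseteq> \<Squnion>\<^bsub>V_ob X\<^esub>\<C>"
      using V.sup_least[OF \<C>' cl] by auto
  qed
qed

text \<open>
  Meets need not be unions, but they are on the trace on \<open>X\<^sub>0\<close>: if a point of \<open>X\<^sub>0\<close> is missed by
  finitely many admissible closed sets then all of them lie in one admissible clopen set missing
  the point, because the admissible clopen sets that miss it form a directed family.
\<close>

lemma V_ob_finite_inf_trace:
  assumes \<F>: "finite \<F>" "\<F> \<subseteq> adm_closed X"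
  shows "dist_pts X \<inter> \<Sqinter>\<^bsub>V_ob X\<^esub>\<F> = dist_pts X \<inter> \<Union>\<F>"
proof -
  interpret V: complete_lattice "V_ob X" by (rule V_ob_complete_lattice)
  have \<F>': "\<F> \<subseteq> carrier (V_ob X)"
    using \<F> by simp
  have "\<Union>\<F> \<subseteq> \<Sqinter>\<^bsub>V_ob X\<^esub>\<F>"
    using V.inf_lower[OF \<F>'] by auto
  moreover have "y \<notin> \<Sqinter>\<^bsub>V_ob X\<^esub>\<F>" if y: "y \<in> dist_pts X" "y \<notin> \<Union>\<F>" for y
  proof -
    have "closedin (topo X) (\<Union>\<F>)"
      using \<F> adm_closedD(1) by (intro closedin_Union) auto
    moreover have "upset X (\<Union>\<F>)"
      unfolding upset_def
    proof (intro conjI ballI impI)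
      show "\<Union>\<F> \<subseteq> carrier X"
        using \<F>(2) adm_closedD(3)[where X=X] by auto
      fix x z assume xz: "x \<in> \<Union>\<F>" "z \<in> carrier X" "x \<sqsubseteq> z"
      then obtain C where C: "C \<in> \<F>" "x \<in> C"
        by blast
      then have "z \<in> C"
        using upsetD[OF adm_closedD(2)[of C X] C(2)] \<F>(2) xz by auto
      then show "z \<in> \<Union>\<F>"
        using C by blast
    qed
    ultimately have "\<exists>W\<in>adm_missing X y. \<Union>\<F> \<subseteq> W"
      using y by (intro adm_clopen_separates_dist_pt)
    then obtain W where W: "W \<in> adm_missing X y" "\<Union>\<F> \<subseteq> W"
      by (elim bexE)
    have "W \<in> carrier (V_ob X)"
      using W(1) adm_clopen_closed by (simp add: adm_missing_def)
    then have "\<Sqinter>\<^bsub>V_ob X\<^esub>\<F> \<subseteq> W"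
      using V.inf_greatest[OF \<F>'] W(2) by auto
    then show ?thesis
      using W(1) by (auto simp: adm_missing_def)
  qed
  ultimately show ?thesis
    by blast
qed

text \<open>
  Joins are intersections here.  An open set that contains an intersection of closed sets contains
  a finite subintersection, so admissible clopen upsets are compact.  Conversely every admissible
  closed upset is an intersection of admissible clopen ones, and if finitely many of these suffice
  then it is clopen.
\<close>

lemma V_ob_compact_elements: "compact_elements (V_ob X) = adm_clopen X"
proof (intro equalityI subsetI)
  interpret V: complete_lattice "V_ob X" by (rule V_ob_complete_lattice)
  fix C assume C: "C \<in> compact_elements (V_ob X)"
  then have Cc: "C \<in> adm_closed X"
    using V.compact_elements_carrier by auto
  let ?\<U> = "{U \<in> adm_clopen X. C \<subseteq> U}"
  have \<U>: "?\<U> \<subseteq> adm_closed X"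
    using adm_clopen_closed by blast
  have "C \<sqsubseteq>\<^bsub>V_ob X\<^esub> \<Squnion>\<^bsub>V_ob X\<^esub>?\<U>"
    using adm_closed_eq_Inter[OF Cc] V_ob_sup[OF \<U>] by simp
  then obtain \<F> where \<F>: "\<F> \<subseteq> ?\<U>" "finite \<F>" "C \<sqsubseteq>\<^bsub>V_ob X\<^esub> \<Squnion>\<^bsub>V_ob X\<^esub>\<F>"
    using V.compact_elementsD[OF C, of ?\<U>] \<U> by auto
  have \<F>': "\<F> \<subseteq> adm_clopen X" "\<F> \<subseteq> adm_closed X"
    using \<F> \<U> by auto
  have "carrier X \<inter> \<Inter>\<F> \<subseteq> C"
    using \<F>(3) V_ob_sup[OF \<F>'(2)] by simp
  then have "C = carrier X \<inter> \<Inter>\<F>"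
    using \<F>(1) adm_closedD(3)[OF Cc] by blast
  then show "C \<in> adm_clopen X"
    using adm_clopen_finite_Inter[OF \<F>(2) \<F>'(1)] by simp
next
  fix U assume U: "U \<in> adm_clopen X"
  have "\<exists>\<F>\<subseteq>\<C>. finite \<F> \<and> U \<sqsubseteq>\<^bsub>V_ob X\<^esub> \<Squnion>\<^bsub>V_ob X\<^esub>\<F>"
    if \<C>: "\<C> \<subseteq> adm_closed X" "U \<sqsubseteq>\<^bsub>V_ob X\<^esub> \<Squnion>\<^bsub>V_ob X\<^esub>\<C>" for \<C>
  proof -
    have "topspace (topo X) \<inter> \<Inter>\<C> \<subseteq> U"
      using \<C> V_ob_sup[OF \<C>(1)] by (simp add: topspace_topo)
    moreover have "\<And>C. C \<in> \<C> \<Longrightarrow> closedin (topo X) C"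
      using \<C>(1) adm_closedD(1)[where X=X] by auto
    ultimately have "\<exists>\<F>\<subseteq>\<C>. finite \<F> \<and> topspace (topo X) \<inter> \<Inter>\<F> \<subseteq> U"
      by (intro compact_space_Inter_subset_open[OF compact_topo _ clopen_upsetD(1)[OF adm_clopenD[OF U]]])
    then obtain \<F> where \<F>: "\<F> \<subseteq> \<C>" "finite \<F>" "topspace (topo X) \<inter> \<Inter>\<F> \<subseteq> U"
      by (elim exE conjE)
    have "\<F> \<subseteq> adm_closed X"
      using \<F> \<C> by blast
    then have "U \<sqsubseteq>\<^bsub>V_ob X\<^esub> \<Squnion>\<^bsub>V_ob X\<^esub>\<F>"
      using \<F>(3) V_ob_sup by (simp add: topspace_topo)
    then show ?thesis
      using \<F> by blast
  qed
  then show "U \<in> compact_elements (V_ob X)"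
    using adm_clopen_closed[OF U] by (simp add: compact_elements_def)
qed

text \<open>
  An admissible closed set is determined by its trace on \<open>X\<^sub>0\<close>, and taking traces turns joins
  into intersections and finite meets into unions.  So distributivity is inherited from sets.
\<close>

lemma V_ob_algebraic_frame: "algebraic_frame (V_ob X)"
proof -
  interpret V: complete_lattice "V_ob X" by (rule V_ob_complete_lattice)
  have meet: "dist_pts X \<inter> (C \<sqinter>\<^bsub>V_ob X\<^esub> D) = dist_pts X \<inter> (C \<union> D)"
    if "C \<in> adm_closed X" "D \<in> adm_closed X" for C D
    using V_ob_finite_inf_trace[of "{C, D}"] that by (simp add: meet_def)
  show ?thesis
  proof unfold_locales
    fix C \<S> assume "C \<in> carrier (V_ob X)" "\<S> \<subseteq> carrier (V_ob X)"
    then have C: "C \<in> adm_closed X" and \<S>: "\<S> \<subseteq> adm_closed X"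
      by auto
    let ?l = "C \<sqinter>\<^bsub>V_ob X\<^esub> \<Squnion>\<^bsub>V_ob X\<^esub>\<S>" and ?m = "(\<lambda>s. C \<sqinter>\<^bsub>V_ob X\<^esub> s) ` \<S>"
    have sup: "\<Squnion>\<^bsub>V_ob X\<^esub>\<S> \<in> adm_closed X"
      using V.sup_closed[of \<S>] \<S> by simp
    have l: "?l \<in> adm_closed X"
      using V.meet_closed[of C "\<Squnion>\<^bsub>V_ob X\<^esub>\<S>"] C sup by simp
    have m: "?m \<subseteq> adm_closed X"
    proof
      fix D assume "D \<in> ?m"
      then obtain s where "s \<in> \<S>" "D = C \<sqinter>\<^bsub>V_ob X\<^esub> s"
        by blast
      then show "D \<in> adm_closed X"
        using V.meet_closed[of C s] C \<S> by auto
    qed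
    have r: "\<Squnion>\<^bsub>V_ob X\<^esub>?m \<in> adm_closed X"
      using V.sup_closed[of ?m] m by simp
    have "dist_pts X \<inter> ?l = dist_pts X \<inter> (C \<union> \<Inter>\<S>)"
    proof -
      have "dist_pts X \<inter> (C \<union> (carrier X \<inter> \<Inter>\<S>)) = dist_pts X \<inter> (C \<union> \<Inter>\<S>)"
        using dist_pts_carrier by blast
      then show ?thesis
        using meet[OF C sup] V_ob_sup[OF \<S>] by simp
    qed
    also have "\<dots> = dist_pts X \<inter> (\<Inter>s\<in>\<S>. dist_pts X \<inter> (C \<union> s))"
      by blast
    also have "\<dots> = dist_pts X \<inter> (\<Inter>s\<in>\<S>. dist_pts X \<inter> (C \<sqinter>\<^bsub>V_ob X\<^esub> s))"
      using meet[OF C subsetD[OF \<S>]] by simp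
    also have "\<dots> = dist_pts X \<inter> \<Squnion>\<^bsub>V_ob X\<^esub>?m"
      unfolding V_ob_sup[OF m] using dist_pts_carrier by blast
    finally show "?l = \<Squnion>\<^bsub>V_ob X\<^esub>?m"
      using adm_closed_subset_iff_trace[OF l r] adm_closed_subset_iff_trace[OF r l] by blast
  next
    fix C assume "C \<in> carrier (V_ob X)"
    then have C: "C \<in> adm_closed X"
      by simp
    let ?\<U> = "{U \<in> adm_clopen X. C \<subseteq> U}"
    have "?\<U> \<subseteq> adm_closed X"
      using adm_clopen_closed by blast
    then have eq: "C = \<Squnion>\<^bsub>V_ob X\<^esub>?\<U>"
      using adm_closed_eq_Inter[OF C] V_ob_sup by simp
    show "\<exists>\<S>\<subseteq>compact_elements (V_ob X). C = \<Squnion>\<^bsub>V_ob X\<^esub>\<S>"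
      unfolding V_ob_compact_elements by (rule exI[of _ ?\<U>], intro conjI, blast, fact eq)
  qed
qed

end


section \<open>The category of pointed generalized Priestley spaces\<close>

lemma pgps_homD:
  assumes "R \<in> pgps_hom X Y"
  shows "R \<subseteq> carrier X \<times> carrier Y"
    "pointed_gen_priestley_space X" "pointed_gen_priestley_space Y"
    "\<And>U. U \<in> adm_clopen Y \<Longrightarrow> box X R U \<in> adm_clopen X"
  using assms by (auto simp: pgps_hom_def)

lemma in_box_iff: "x \<in> box X R U \<longleftrightarrow> x \<in> carrier X \<and> (\<forall>y. (x, y) \<in> R \<longrightarrow> y \<in> U)"
  by (auto simp: box_def)

text \<open>
  The separation condition on morphisms, read contrapositively, recovers \<open>R\<close> from \<open>\<box>\<^sub>R\<close>.
\<close>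

lemma pgps_hom_iff_box:
  assumes "R \<in> pgps_hom X Y" "x \<in> carrier X" "y \<in> carrier Y"
  shows "(x, y) \<in> R \<longleftrightarrow> (\<forall>U \<in> adm_clopen Y. x \<in> box X R U \<longrightarrow> y \<in> U)"
proof
  assume "(x, y) \<in> R"
  then show "\<forall>U \<in> adm_clopen Y. x \<in> box X R U \<longrightarrow> y \<in> U"
    by (auto simp: box_def)
next
  assume *: "\<forall>U \<in> adm_clopen Y. x \<in> box X R U \<longrightarrow> y \<in> U"
  show "(x, y) \<in> R"
  proof (rule ccontr)
    assume "(x, y) \<notin> R"
    then obtain U where "U \<in> adm_clopen Y" "R `` {x} \<subseteq> U" "y \<notin> U"
      using assms unfolding pgps_hom_def by blast
    then show False
      using * assms(2) by (auto simp: box_def)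
  qed
qed

lemma pgps_homI:
  assumes X: "pointed_gen_priestley_space X" and Y: "pointed_gen_priestley_space Y"
    and sub: "R \<subseteq> carrier X \<times> carrier Y"
    and sep: "\<And>x y. \<lbrakk>x \<in> carrier X; y \<in> carrier Y; \<And>U. \<lbrakk>U \<in> adm_clopen Y; x \<in> box X R U\<rbrakk> \<Longrightarrow> y \<in> U\<rbrakk>
                \<Longrightarrow> (x, y) \<in> R"
    and box: "\<And>U. U \<in> adm_clopen Y \<Longrightarrow> box X R U \<in> adm_clopen X"
  shows "R \<in> pgps_hom X Y"
  unfolding pgps_hom_def
proof (intro CollectI conjI ballI impI)
  fix x y assume xy: "x \<in> carrier X" "y \<in> carrier Y" "(x, y) \<notin> R"
  show "\<exists>U \<in> adm_clopen Y. R `` {x} \<subseteq> U \<and> y \<notin> U"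
  proof (rule ccontr)
    assume no: "\<not> ?thesis"
    have "(x, y) \<in> R"
      using xy(1,2)
    proof (rule sep)
      fix U assume "U \<in> adm_clopen Y" "x \<in> box X R U"
      then show "y \<in> U"
        using no by (auto simp: box_def)
    qed
    then show False
      using xy by simp
  qed
qed (use X Y sub box in auto)

text \<open>
  As a morphism \<open>R\<close> is recovered from \<open>\<box>\<^sub>R\<close> on admissible clopen upsets, and composition of
  morphisms turns into composition of boxes in reverse order, every equation between morphisms of
  spaces becomes an equation between maps of admissible clopen upsets.
\<close>

lemma pgps_hom_eqI:
  assumes R: "R \<in> pgps_hom X Y" and S: "S \<in> pgps_hom X Y"
    and eq: "\<And>U. U \<in> adm_clopen Y \<Longrightarrow> box X R U = box X S U"
  shows "R = S"
proof -
  have "(x, y) \<in> R \<longleftrightarrow> (x, y) \<in> S" for x y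
  proof (cases "x \<in> carrier X \<and> y \<in> carrier Y")
    case True
    then show ?thesis
      using pgps_hom_iff_box[OF R, of x y] pgps_hom_iff_box[OF S, of x y] eq by simp
  next
    case False
    then show ?thesis
      using pgps_homD(1)[OF R] pgps_homD(1)[OF S] by blast
  qed
  then show ?thesis
    by auto
qed

text \<open>
  The defining condition of the composite gives one inclusion.  The other holds because the composite
  contains all pairs \<open>(x, z)\<close> with \<open>x R y\<close> and \<open>y S z\<close>.
\<close>

lemma box_pgps_comp:
  assumes R: "R \<subseteq> carrier X \<times> carrier Y" and S: "S \<subseteq> carrier Y \<times> carrier Z"
    and U: "U \<in> adm_clopen Z"
  shows "box X (pgps_comp X Y Z S R) U = box X R (box Y S U)"
proof (intro equalityI subsetI)
  fix x assume "x \<in> box X R (box Y S U)"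
  then show "x \<in> box X (pgps_comp X Y Z S R) U"
    using U by (auto simp: pgps_comp_def box_def)
next
  fix x assume x: "x \<in> box X (pgps_comp X Y Z S R) U"
  have "z \<in> U" if "(x, y) \<in> R" "(y, z) \<in> S" for y z
  proof -
    have "(x, z) \<in> pgps_comp X Y Z S R"
      using that R S by (auto simp: pgps_comp_def in_box_iff)
    then show ?thesis
      using x by (simp add: in_box_iff)
  qed
  then show "x \<in> box X R (box Y S U)"
    using x R by (auto simp: in_box_iff)
qed

lemma pgps_comp_hom:
  assumes R: "R \<in> pgps_hom X Y" and S: "S \<in> pgps_hom Y Z"
  shows "pgps_comp X Y Z S R \<in> pgps_hom X Z"
proof (rule pgps_homI)
  note box = box_pgps_comp[OF pgps_homD(1)[OF R] pgps_homD(1)[OF S]]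
  show "pgps_comp X Y Z S R \<subseteq> carrier X \<times> carrier Z"
    by (auto simp: pgps_comp_def)
  show "(x, z) \<in> pgps_comp X Y Z S R" if "x \<in> carrier X" "z \<in> carrier Z"
    "\<And>U. \<lbrakk>U \<in> adm_clopen Z; x \<in> box X (pgps_comp X Y Z S R) U\<rbrakk> \<Longrightarrow> z \<in> U" for x z
    using that box by (simp add: pgps_comp_def)
  show "box X (pgps_comp X Y Z S R) U \<in> adm_clopen X" if "U \<in> adm_clopen Z" for U
    using that box pgps_homD(4)[OF R] pgps_homD(4)[OF S] by simp
qed (use pgps_homD[OF R] pgps_homD[OF S] in auto)

lemma box_pgps_id:
  assumes X: "partial_order X" and U: "upset X U"
  shows "box X (pgps_id X) U = U"
proof -
  interpret partial_order X by (rule X)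
  show ?thesis
    using U by (auto simp: box_def pgps_id_def upset_def)
qed

lemma pgps_partial_order: "pointed_gen_priestley_space X \<Longrightarrow> partial_order X"
  by (simp add: pointed_gen_priestley_space_def priestley_space_def)

lemma box_pgps_id_adm_clopen:
  assumes "pointed_gen_priestley_space X" "U \<in> adm_clopen X"
  shows "box X (pgps_id X) U = U"
  using box_pgps_id[OF pgps_partial_order] assms clopen_upsetD(3)[OF adm_clopenD] by blast

lemma pgps_id_hom:
  assumes X: "pointed_gen_priestley_space X"
  shows "pgps_id X \<in> pgps_hom X X"
proof (rule pgps_homI[OF X X])
  interpret pointed_gen_priestley_space X by (rule X)
  show "(x, y) \<in> pgps_id X" if "x \<in> carrier X" "y \<in> carrier X"
    "\<And>U. \<lbrakk>U \<in> adm_clopen X; x \<in> box X (pgps_id X) U\<rbrakk> \<Longrightarrow> y \<in> U" for x y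
    using that le_iff_adm[OF that(1,2)] box_pgps_id_adm_clopen[OF X] by (simp add: pgps_id_def)
  show "box X (pgps_id X) U \<in> adm_clopen X" if "U \<in> adm_clopen X" for U
    using that box_pgps_id_adm_clopen[OF X] by simp
qed (auto simp: pgps_id_def)

lemma pgps_comp_id:
  assumes R: "R \<in> pgps_hom X Y"
  shows "pgps_comp X X Y R (pgps_id X) = R" "pgps_comp X Y Y (pgps_id Y) R = R"
proof -
  note X = pgps_id_hom[OF pgps_homD(2)[OF R]] and Y = pgps_id_hom[OF pgps_homD(3)[OF R]]
  show "pgps_comp X X Y R (pgps_id X) = R"
  proof (rule pgps_hom_eqI[OF pgps_comp_hom[OF X R] R])
    fix U assume U: "U \<in> adm_clopen Y"
    show "box X (pgps_comp X X Y R (pgps_id X)) U = box X R U"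
      using box_pgps_comp[OF pgps_homD(1)[OF X] pgps_homD(1)[OF R] U] pgps_homD(4)[OF R U]
        box_pgps_id_adm_clopen[OF pgps_homD(2)[OF R]] by simp
  qed
  show "pgps_comp X Y Y (pgps_id Y) R = R"
  proof (rule pgps_hom_eqI[OF pgps_comp_hom[OF R Y] R])
    fix U assume U: "U \<in> adm_clopen Y"
    show "box X (pgps_comp X Y Y (pgps_id Y) R) U = box X R U"
      using box_pgps_comp[OF pgps_homD(1)[OF R] pgps_homD(1)[OF Y] U]
        box_pgps_id_adm_clopen[OF pgps_homD(3)[OF R] U] by simp
  qed
qed

lemma pgps_comp_assoc:
  assumes R: "R \<in> pgps_hom X Y" and S: "S \<in> pgps_hom Y Z" and T: "T \<in> pgps_hom Z W"
  shows "pgps_comp X Z W T (pgps_comp X Y Z S R) = pgps_comp X Y W (pgps_comp Y Z W T S) R"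
proof (rule pgps_hom_eqI)
  note RS = pgps_comp_hom[OF R S] and ST = pgps_comp_hom[OF S T]
  show "pgps_comp X Z W T (pgps_comp X Y Z S R) \<in> pgps_hom X W"
    by (rule pgps_comp_hom[OF RS T])
  show "pgps_comp X Y W (pgps_comp Y Z W T S) R \<in> pgps_hom X W"
    by (rule pgps_comp_hom[OF R ST])
  fix U assume U: "U \<in> adm_clopen W"
  have "box X (pgps_comp X Z W T (pgps_comp X Y Z S R)) U
      = box X (pgps_comp X Y Z S R) (box Z T U)"
    by (rule box_pgps_comp[OF pgps_homD(1)[OF RS] pgps_homD(1)[OF T] U])
  also have "\<dots> = box X R (box Y S (box Z T U))"
    by (rule box_pgps_comp[OF pgps_homD(1)[OF R] pgps_homD(1)[OF S] pgps_homD(4)[OF T U]])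
  also have "\<dots> = box X R (box Y (pgps_comp Y Z W T S) U)"
    using box_pgps_comp[OF pgps_homD(1)[OF S] pgps_homD(1)[OF T] U] by simp
  also have "\<dots> = box X (pgps_comp X Y W (pgps_comp Y Z W T S) R) U"
    using box_pgps_comp[OF pgps_homD(1)[OF R] pgps_homD(1)[OF ST] U] by simp
  finally show "box X (pgps_comp X Z W T (pgps_comp X Y Z S R)) U
      = box X (pgps_comp X Y W (pgps_comp Y Z W T S) R) U" .
qed


section \<open>The functor from spaces to frames\<close>

lemma box_Inter:
  assumes "R \<subseteq> carrier X \<times> carrier Y"
  shows "box X R (carrier Y \<inter> \<Inter>\<C>) = carrier X \<inter> \<Inter>(box X R ` \<C>)"
  using assms by (auto simp: in_box_iff)

text \<open>
  Boxes commute with intersections, and every admissible closed upset is an intersection of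
  admissible clopen ones.  This lifts what is known about boxes of admissible clopen upsets to
  admissible closed upsets.
\<close>

lemma box_adm_closed:
  assumes R: "R \<in> pgps_hom X Y" and C: "C \<in> adm_closed Y"
  shows "box X R C \<in> adm_closed X"
proof -
  interpret X: pointed_gen_priestley_space X by (rule pgps_homD(2)[OF R])
  interpret Y: pointed_gen_priestley_space Y by (rule pgps_homD(3)[OF R])
  let ?\<U> = "{U \<in> adm_clopen Y. C \<subseteq> U}"
  have "box X R C = carrier X \<inter> \<Inter>(box X R ` ?\<U>)"
    using Y.adm_closed_eq_Inter[OF C] box_Inter[OF pgps_homD(1)[OF R], of ?\<U>] by simp
  moreover have "box X R ` ?\<U> \<subseteq> adm_closed X"
    using pgps_homD(4)[OF R] X.adm_clopen_closed by blast
  ultimately show ?thesis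
    using X.adm_closed_Inter by simp
qed

lemma V_mor_hom:
  assumes R: "R \<in> pgps_hom X Y"
  shows "V_mor X Y R \<in> frm_hom (V_ob Y) (V_ob X)"
proof -
  interpret X: pointed_gen_priestley_space X by (rule pgps_homD(2)[OF R])
  interpret Y: pointed_gen_priestley_space Y by (rule pgps_homD(3)[OF R])
  interpret V: complete_lattice "V_ob Y" by (rule Y.V_ob_complete_lattice)
  have "V_mor X Y R (\<Squnion>\<^bsub>V_ob Y\<^esub>\<C>) = \<Squnion>\<^bsub>V_ob X\<^esub>(V_mor X Y R ` \<C>)" if \<C>: "\<C> \<subseteq> adm_closed Y" for \<C>
  proof -
    have im: "V_mor X Y R ` \<C> = box X R ` \<C>"
      using \<C> by (intro image_cong) (auto simp: V_mor_def)
    have "box X R ` \<C> \<subseteq> adm_closed X"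
      using \<C> box_adm_closed[OF R] by blast
    then have "\<Squnion>\<^bsub>V_ob X\<^esub>(box X R ` \<C>) = carrier X \<inter> \<Inter>(box X R ` \<C>)"
      by (rule X.V_ob_sup)
    moreover have "V_mor X Y R (\<Squnion>\<^bsub>V_ob Y\<^esub>\<C>) = box X R (carrier Y \<inter> \<Inter>\<C>)"
      using Y.V_ob_sup[OF \<C>] Y.adm_closed_Inter[OF \<C>] by (simp add: V_mor_def)
    ultimately show ?thesis
      using im box_Inter[OF pgps_homD(1)[OF R], of \<C>] by simp
  qed
  moreover have "V_mor X Y R U \<in> compact_elements (V_ob X)" if "U \<in> compact_elements (V_ob Y)" for U
    using that pgps_homD(4)[OF R] Y.adm_clopen_closed
    by (simp add: X.V_ob_compact_elements Y.V_ob_compact_elements V_mor_def)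
  moreover have "V_mor X Y R \<in> carrier (V_ob Y) \<rightarrow>\<^sub>E carrier (V_ob X)"
    using box_adm_closed[OF R] by (simp add: V_mor_def)
  ultimately show ?thesis
    using X.V_ob_algebraic_frame Y.V_ob_algebraic_frame by (simp add: frm_hom_def)
qed

lemma V_mor_id:
  assumes X: "pointed_gen_priestley_space X"
  shows "V_mor X X (pgps_id X) = frm_id (V_ob X)"
  unfolding V_mor_def frm_id_def
  using box_pgps_id[OF pgps_partial_order[OF X] adm_closedD(2)[where X=X]]
  by (intro restrict_ext) simp

lemma V_mor_comp:
  assumes R: "R \<in> pgps_hom X Y" and S: "S \<in> pgps_hom Y Z"
  shows "V_mor X Z (pgps_comp X Y Z S R) = frm_comp (V_ob Z) (V_mor X Y R) (V_mor Y Z S)"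
proof -
  interpret Z: pointed_gen_priestley_space Z by (rule pgps_homD(3)[OF S])
  note sub = pgps_homD(1)[OF R] pgps_homD(1)[OF S]
  have "box X (pgps_comp X Y Z S R) C = box X R (box Y S C)" if C: "C \<in> adm_closed Z" for C
  proof -
    let ?\<U> = "{U \<in> adm_clopen Z. C \<subseteq> U}"
    have C_eq: "C = carrier Z \<inter> \<Inter>?\<U>"
      by (rule Z.adm_closed_eq_Inter[OF C])
    have "box X (pgps_comp X Y Z S R) (carrier Z \<inter> \<Inter>?\<U>)
        = carrier X \<inter> \<Inter>(box X (pgps_comp X Y Z S R) ` ?\<U>)"
      by (rule box_Inter[OF pgps_homD(1)[OF pgps_comp_hom[OF R S]]])
    also have "box X (pgps_comp X Y Z S R) ` ?\<U> = (\<lambda>U. box X R (box Y S U)) ` ?\<U>"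
      by (intro image_cong refl box_pgps_comp[OF sub]) simp
    also have "\<dots> = box X R ` box Y S ` ?\<U>"
      by (simp add: image_image)
    also have "carrier X \<inter> \<Inter>(box X R ` box Y S ` ?\<U>) = box X R (box Y S (carrier Z \<inter> \<Inter>?\<U>))"
      using box_Inter[OF sub(1)] box_Inter[OF sub(2)] by metis
    finally show ?thesis
      using C_eq by metis
  qed
  then show ?thesis
    using box_adm_closed[OF S]
    by (auto simp: V_mor_def frm_comp_def compose_def restrict_def fun_eq_iff)
qed


section \<open>The space of pseudoprime elements\<close>

lemma Y_ob_simps [simp]:
  "carrier (Y_ob L) = Y_carrier L" "eq (Y_ob L) = (=)" "x \<sqsubseteq>\<^bsub>Y_ob L\<^esub> y \<longleftrightarrow> x \<sqsubseteq>\<^bsub>L\<^esub> y"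
  "topo (Y_ob L) = subtopology (lambda_topology L) (Y_carrier L)"
  "dist_pts (Y_ob L) = prime_elements L" "max_pt (Y_ob L) = \<top>\<^bsub>L\<^esub>"
  by (simp_all add: Y_ob_def)

text \<open>The upset \<open>\<up>a\<close> of the space of \<open>L\<close>, where \<open>a\<close> need not be a point of that space.\<close>

definition Y_up :: "('a, 'b) gorder_scheme \<Rightarrow> 'a \<Rightarrow> 'a set" where
  "Y_up L a = principal_up L a \<inter> Y_carrier L"

context
  fixes L :: "'a gorder"
  assumes L: "algebraic_frame L"
begin

interpretation algebraic_frame L by (rule L)

lemma in_Y_up_iff: "x \<in> Y_up L a \<longleftrightarrow> x \<in> Y_carrier L \<and> a \<sqsubseteq>\<^bsub>L\<^esub> x"
  using Y_carrier_subset by (auto simp: Y_up_def principal_up_def)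

text \<open>
  Since \<open>L\<close> is spatial, already the prime elements above \<open>a\<close> determine \<open>a\<close>.
\<close>

lemma Y_up_subset_iff:
  assumes a: "a \<in> carrier L" and b: "b \<in> carrier L"
  shows "Y_up L a \<subseteq> Y_up L b \<longleftrightarrow> b \<sqsubseteq>\<^bsub>L\<^esub> a"
proof
  assume "b \<sqsubseteq>\<^bsub>L\<^esub> a"
  then show "Y_up L a \<subseteq> Y_up L b"
    using le_trans[OF \<open>b \<sqsubseteq>\<^bsub>L\<^esub> a\<close>] a b Y_carrier_subset by (auto simp: in_Y_up_iff)
next
  assume "Y_up L a \<subseteq> Y_up L b"
  then have "\<forall>q\<in>prime_elements L. a \<sqsubseteq>\<^bsub>L\<^esub> q \<longrightarrow> b \<sqsubseteq>\<^bsub>L\<^esub> q"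
    using prime_in_Y_carrier by (auto simp: in_Y_up_iff subset_iff)
  then show "b \<sqsubseteq>\<^bsub>L\<^esub> a"
    using le_iff_primes[OF b a] by simp
qed

lemma Y_up_sup:
  assumes "S \<subseteq> carrier L"
  shows "Y_up L (\<Squnion>\<^bsub>L\<^esub>S) = Y_carrier L \<inter> \<Inter>(Y_up L ` S)"
  using sup_le_iff[OF assms] Y_carrier_subset by (auto simp: in_Y_up_iff)

lemma topspace_Y_ob: "topspace (topo (Y_ob L)) = Y_carrier L"
  using Y_carrier_subset by (auto simp: topspace_lambda)

lemma clopen_upset_Y_up:
  assumes k: "k \<in> compact_elements L"
  shows "clopen_upset (Y_ob L) (Y_up L k)"
proof -
  have "Y_up L k = Y_carrier L \<inter> principal_up L k"
    by (auto simp: Y_up_def)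
  then have "openin (topo (Y_ob L)) (Y_up L k)" "closedin (topo (Y_ob L)) (Y_up L k)"
    using openin_principal_up[OF k] closedin_principal_up[OF k]
    by (auto simp: openin_subtopology closedin_subtopology)
  moreover have "upset (Y_ob L) (Y_up L k)"
    unfolding upset_def
  proof (intro conjI ballI impI)
    show "Y_up L k \<subseteq> carrier (Y_ob L)"
      by (auto simp: Y_up_def)
    fix x y assume xy: "x \<in> Y_up L k" "y \<in> carrier (Y_ob L)" "x \<sqsubseteq>\<^bsub>Y_ob L\<^esub> y"
    then have "k \<sqsubseteq>\<^bsub>L\<^esub> y"
      using le_trans[of k x y] compact_elements_carrier[OF k] Y_carrier_subset
      by (auto simp: in_Y_up_iff)
    then show "y \<in> Y_up L k"
      using xy by (simp add: in_Y_up_iff)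
  qed
  ultimately show ?thesis
    by (simp add: clopen_upset_def)
qed

lemma Y_ob_priestley: "priestley_space (Y_ob L)"
proof -
  note sub = subsetD[OF Y_carrier_subset]
  interpret Y: partial_order "Y_ob L"
    using sub by unfold_locales (auto intro: le_trans[OF _ _ sub sub sub] le_antisym[OF _ _ sub sub])
  show ?thesis
  proof unfold_locales
    show "topspace (topo (Y_ob L)) = carrier (Y_ob L)"
      using topspace_Y_ob by simp
    show "compact_space (topo (Y_ob L))"
      using closedin_compact_space[OF compact_space_lambda closedin_Y_carrier]
      by (simp add: compact_space_subtopology)
    fix x y assume xy: "x \<in> carrier (Y_ob L)" "y \<in> carrier (Y_ob L)" "\<not> x \<sqsubseteq>\<^bsub>Y_ob L\<^esub> y"
    then obtain k where k: "k \<in> compact_elements L" "k \<sqsubseteq>\<^bsub>L\<^esub> x" "\<not> k \<sqsubseteq>\<^bsub>L\<^esub> y"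
      using compact_below_not_below[of x y] sub[of x] sub[of y] by auto
    have "clopen_upset (Y_ob L) (Y_up L k)" "x \<in> Y_up L k" "y \<notin> Y_up L k"
      using clopen_upset_Y_up[OF k(1)] k xy by (auto simp: in_Y_up_iff)
    then show "\<exists>U. clopen_upset (Y_ob L) U \<and> x \<in> U \<and> y \<notin> U"
      by blast
  qed
qed

interpretation Y: priestley_space "Y_ob L" by (rule Y_ob_priestley)

lemma dist_pts_Y_ob: "dist_pts (Y_ob L) \<subseteq> carrier (Y_ob L)"
  using prime_in_Y_carrier by auto

lemma Y_up_eq_Inter_of_compacts:
  assumes a: "a \<in> carrier L"
  shows "\<exists>S \<subseteq> compact_elements L. a = \<Squnion>\<^bsub>L\<^esub>S \<and> Y_up L a = Y_carrier L \<inter> \<Inter>(Y_up L ` S)"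
proof -
  obtain S where S: "S \<subseteq> compact_elements L" "a = \<Squnion>\<^bsub>L\<^esub>S"
    using sup_of_compacts[OF a] by metis
  moreover have "S \<subseteq> carrier L"
    using S(1) compact_elements_carrier by blast
  ultimately show ?thesis
    using Y_up_sup[of S] by metis
qed

text \<open>
  Such a set is closed as an intersection of sets \<open>\<up>k\<close> with \<open>k\<close> compact, and a point outside it lies
  below a prime element outside it by spatiality.
\<close>

lemma Y_up_adm_closed:
  assumes a: "a \<in> carrier L"
  shows "Y_up L a \<in> adm_closed (Y_ob L)"
proof -
  obtain S where S: "S \<subseteq> compact_elements L" "Y_up L a = Y_carrier L \<inter> \<Inter>(Y_up L ` S)"
    using Y_up_eq_Inter_of_compacts[OF a] by metis
  have cl: "closedin (topo (Y_ob L)) (Y_up L k)" if "k \<in> S" for k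
    using clopen_upsetD(2)[OF clopen_upset_Y_up] that S(1) by blast
  have "closedin (topo (Y_ob L)) (Y_carrier L)"
    using clopen_upsetD(2)[OF Y.clopen_upset_carrier] by simp
  then have "closedin (topo (Y_ob L)) (\<Inter>(insert (Y_carrier L) (Y_up L ` S)))"
    using cl by (intro closedin_Inter) blast+
  then have closed: "closedin (topo (Y_ob L)) (Y_up L a)"
    using S(2) by simp
  have up: "upset (Y_ob L) (Y_up L a)"
    unfolding upset_def
  proof (intro conjI ballI impI)
    fix x y assume "x \<in> Y_up L a" "y \<in> carrier (Y_ob L)" "x \<sqsubseteq>\<^bsub>Y_ob L\<^esub> y"
    then show "y \<in> Y_up L a"
      using le_trans[of a x y] a Y_carrier_subset by (auto simp: in_Y_up_iff)
  qed (auto simp: Y_up_def)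
  have "x \<in> down_closure (Y_ob L) (dist_pts (Y_ob L) - Y_up L a)"
    if x: "x \<in> Y_carrier L" "x \<notin> Y_up L a" for x
  proof -
    have "\<not> a \<sqsubseteq>\<^bsub>L\<^esub> x" "x \<in> carrier L"
      using x Y_carrier_subset by (auto simp: in_Y_up_iff)
    then obtain q where "q \<in> prime_elements L" "x \<sqsubseteq>\<^bsub>L\<^esub> q" "\<not> a \<sqsubseteq>\<^bsub>L\<^esub> q"
      using prime_above_separating[of x a] a by metis
    then show ?thesis
      using x by (auto simp: down_closure_def in_Y_up_iff)
  qed
  moreover have "x \<in> Y_carrier L - Y_up L a"
    if x: "x \<in> down_closure (Y_ob L) (dist_pts (Y_ob L) - Y_up L a)" for x
  proof -
    obtain q where q: "x \<in> Y_carrier L" "q \<in> prime_elements L" "q \<notin> Y_up L a" "x \<sqsubseteq>\<^bsub>L\<^esub> q"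
      using x by (auto simp: down_closure_def)
    then show ?thesis
      using upsetD[OF up, of x q] prime_in_Y_carrier[OF q(2)] by auto
  qed
  ultimately have "carrier (Y_ob L) - Y_up L a = down_closure (Y_ob L) (dist_pts (Y_ob L) - Y_up L a)"
    by auto
  then show ?thesis
    using closed up by (simp add: adm_closed_def)
qed

text \<open>
  Points of a closed upset \<open>C\<close> that are not below the prime element \<open>q\<close> are separated from \<open>q\<close> by
  compact elements; by compactness of \<open>C\<close> finitely many suffice, and by primeness of \<open>q\<close> these have
  a common compact lower bound not below \<open>q\<close>.
\<close>

lemma closed_upset_prime_separation:
  assumes C: "closedin (topo (Y_ob L)) C" "upset (Y_ob L) C" and q: "q \<in> prime_elements L" "q \<notin> C"
  shows "\<exists>c\<in>compact_elements L. C \<subseteq> Y_up L c \<and> \<not> c \<sqsubseteq>\<^bsub>L\<^esub> q"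
proof -
  have qc: "q \<in> carrier L" "q \<noteq> \<top>\<^bsub>L\<^esub>"
    using q by (auto simp: prime_elements_def)
  define N where "N = {k \<in> compact_elements L. \<not> k \<sqsubseteq>\<^bsub>L\<^esub> q}"
  have "C \<subseteq> \<Union>(Y_up L ` N)"
  proof
    fix x assume x: "x \<in> C"
    then have xY: "x \<in> Y_carrier L"
      using C(2) by (auto simp: upset_def)
    have "\<not> x \<sqsubseteq>\<^bsub>L\<^esub> q"
      using upsetD[OF C(2) x, of q] q prime_in_Y_carrier[OF q(1)] by auto
    then obtain k where "k \<in> compact_elements L" "k \<sqsubseteq>\<^bsub>L\<^esub> x" "\<not> k \<sqsubseteq>\<^bsub>L\<^esub> q"
      using compact_below_not_below[of x q] subsetD[OF Y_carrier_subset xY] qc by metis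
    then show "x \<in> \<Union>(Y_up L ` N)"
      using xY by (auto simp: in_Y_up_iff N_def)
  qed
  then have "\<exists>\<F>. finite \<F> \<and> \<F> \<subseteq> Y_up L ` N \<and> C \<subseteq> \<Union>\<F>"
    using clopen_upsetD(1)[OF clopen_upset_Y_up]
    by (intro compactinD[OF closedin_compact_space[OF Y.compact_topo C(1)]]) (auto simp: N_def)
  then obtain \<F> where \<F>: "finite \<F>" "\<F> \<subseteq> Y_up L ` N" "C \<subseteq> \<Union>\<F>"
    by (elim exE conjE)
  obtain G where G: "G \<subseteq> N" "finite G" "\<F> = Y_up L ` G"
    using finite_subset_image[OF \<F>(1,2)] by metis
  have "\<not> \<top>\<^bsub>L\<^esub> \<sqsubseteq>\<^bsub>L\<^esub> q"
    using qc le_antisym[of q "\<top>\<^bsub>L\<^esub>"] by auto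
  \<comment> \<open>adding the top element does not change the meet but excludes the empty family\<close>
  let ?G = "insert \<top>\<^bsub>L\<^esub> G"
  have GN: "\<forall>g\<in>?G. \<not> g \<sqsubseteq>\<^bsub>L\<^esub> q"
    using G(1) \<open>\<not> \<top>\<^bsub>L\<^esub> \<sqsubseteq>\<^bsub>L\<^esub> q\<close> by (auto simp: N_def)
  have Gc: "?G \<subseteq> carrier L"
    using G(1) compact_elements_carrier by (auto simp: N_def)
  have "\<not> \<Sqinter>\<^bsub>L\<^esub>?G \<sqsubseteq>\<^bsub>L\<^esub> q"
    using prime_finite_inf[OF q(1) _ _ Gc] G(2) GN by auto
  then obtain c where c: "c \<in> compact_elements L" "c \<sqsubseteq>\<^bsub>L\<^esub> \<Sqinter>\<^bsub>L\<^esub>?G" "\<not> c \<sqsubseteq>\<^bsub>L\<^esub> q"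
    using compact_below_not_below[of "\<Sqinter>\<^bsub>L\<^esub>?G" q] inf_closed[OF Gc] qc(1) by metis
  have cc: "c \<in> carrier L"
    using compact_elements_carrier[OF c(1)] .
  have below: "c \<sqsubseteq>\<^bsub>L\<^esub> g" if "g \<in> G" for g
    using le_inf_iff[OF Gc cc] c(2) that by simp
  have "C \<subseteq> Y_up L c"
  proof
    fix x assume "x \<in> C"
    then obtain g where g: "g \<in> G" "x \<in> Y_up L g"
      using \<F>(3) G(3) by blast
    then have "g \<in> carrier L" "x \<in> carrier L"
      using Gc Y_carrier_subset by (auto simp: in_Y_up_iff)
    then show "x \<in> Y_up L c"
      using le_trans[OF below[OF g(1)], of x] cc g(2) by (auto simp: in_Y_up_iff)
  qed
  then show ?thesis
    using c by blast
qed

text \<open>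
  Take the join \<open>a\<close> of all compact \<open>c\<close> with \<open>C \<subseteq> \<up>c\<close>.  A point outside \<open>C\<close> lies below a prime
  element outside \<open>C\<close>, which some such \<open>c\<close> separates from \<open>C\<close>; so the point is not above \<open>a\<close>.
\<close>

lemma adm_closed_eq_Y_up:
  assumes C: "C \<in> adm_closed (Y_ob L)"
  shows "\<exists>a\<in>carrier L. C = Y_up L a"
proof -
  define A where "A = {c \<in> compact_elements L. C \<subseteq> Y_up L c}"
  have Ac: "A \<subseteq> carrier L"
    using compact_elements_carrier by (auto simp: A_def)
  have CY: "C \<subseteq> Y_carrier L"
    using adm_closedD(3)[OF C] by simp
  have "x \<in> C" if x: "x \<in> Y_carrier L" "\<And>c. c \<in> A \<Longrightarrow> c \<sqsubseteq>\<^bsub>L\<^esub> x" for x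
  proof (rule ccontr)
    assume "x \<notin> C"
    then have "x \<in> down_closure (Y_ob L) (dist_pts (Y_ob L) - C)"
      using adm_closedD(4)[OF C] x(1) by auto
    then obtain q where q: "q \<in> prime_elements L" "q \<notin> C" "x \<sqsubseteq>\<^bsub>L\<^esub> q"
      by (auto simp: down_closure_def)
    obtain c where c: "c \<in> compact_elements L" "C \<subseteq> Y_up L c" "\<not> c \<sqsubseteq>\<^bsub>L\<^esub> q"
      using closed_upset_prime_separation[OF adm_closedD(1,2)[OF C] q(1,2)] by metis
    then have "c \<sqsubseteq>\<^bsub>L\<^esub> x"
      using x(2)[of c] by (simp add: A_def)
    then show False
      using le_trans[OF _ q(3)] c(3) compact_elements_carrier[OF c(1)]
        subsetD[OF Y_carrier_subset x(1)] prime_elements_carrier[OF q(1)] by simp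
  qed
  then have "Y_up L (\<Squnion>\<^bsub>L\<^esub>A) \<subseteq> C"
    unfolding Y_up_sup[OF Ac] by (auto simp: in_Y_up_iff)
  moreover have "C \<subseteq> Y_up L (\<Squnion>\<^bsub>L\<^esub>A)"
    unfolding Y_up_sup[OF Ac] using CY by (auto simp: A_def)
  ultimately show ?thesis
    using sup_closed[OF Ac] by blast
qed

text \<open>
  An admissible clopen upset \<open>\<up>a\<close> is the intersection of the sets \<open>\<up>s\<close>, where \<open>a\<close> is the join of the
  compact elements \<open>s\<close>.  Since it is open, finitely many \<open>s\<close> suffice, and their join is compact.
\<close>

lemma adm_clopen_Y_ob: "adm_clopen (Y_ob L) = Y_up L ` compact_elements L"
proof (intro equalityI subsetI)
  fix U assume "U \<in> Y_up L ` compact_elements L"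
  then obtain k where k: "k \<in> compact_elements L" "U = Y_up L k"
    by blast
  then show "U \<in> adm_clopen (Y_ob L)"
    using Y.adm_clopen_iff_open_adm_closed[OF dist_pts_Y_ob]
      clopen_upsetD(1)[OF clopen_upset_Y_up[OF k(1)]]
      Y_up_adm_closed[OF compact_elements_carrier[OF k(1)]] by simp
next
  fix U assume "U \<in> adm_clopen (Y_ob L)"
  then have U: "U \<in> adm_closed (Y_ob L)" "openin (topo (Y_ob L)) U"
    using Y.adm_clopen_iff_open_adm_closed[OF dist_pts_Y_ob] by simp_all
  obtain a where a: "a \<in> carrier L" "U = Y_up L a"
    using adm_closed_eq_Y_up[OF U(1)] by metis
  obtain S where S: "S \<subseteq> compact_elements L" "a = \<Squnion>\<^bsub>L\<^esub>S" "Y_up L a = Y_carrier L \<inter> \<Inter>(Y_up L ` S)"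
    using Y_up_eq_Inter_of_compacts[OF a(1)] by metis
  have Sc: "S \<subseteq> carrier L"
    using S(1) compact_elements_carrier by blast
  have "topspace (topo (Y_ob L)) \<inter> \<Inter>(Y_up L ` S) \<subseteq> U"
    using S(3) a(2) topspace_Y_ob by simp
  moreover have "\<And>C. C \<in> Y_up L ` S \<Longrightarrow> closedin (topo (Y_ob L)) C"
    using clopen_upsetD(2)[OF clopen_upset_Y_up] S(1) by blast
  ultimately have "\<exists>\<F>\<subseteq>Y_up L ` S. finite \<F> \<and> topspace (topo (Y_ob L)) \<inter> \<Inter>\<F> \<subseteq> U"
    using compact_space_Inter_subset_open[OF Y.compact_topo _ U(2), of "Y_up L ` S"] by blast
  then obtain \<F> where \<F>: "\<F> \<subseteq> Y_up L ` S" "finite \<F>" "Y_carrier L \<inter> \<Inter>\<F> \<subseteq> U"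
    using topspace_Y_ob by auto
  obtain F where F: "F \<subseteq> S" "finite F" "\<F> = Y_up L ` F"
    using finite_subset_image[OF \<F>(2,1)] by metis
  have Fc: "F \<subseteq> carrier L"
    using F(1) Sc by blast
  have k: "\<Squnion>\<^bsub>L\<^esub>F \<in> compact_elements L"
    using F S(1) by (intro finite_sup_compact) auto
  have "Y_up L (\<Squnion>\<^bsub>L\<^esub>F) \<subseteq> U"
    using \<F>(3) F(3) Y_up_sup[OF Fc] by simp
  moreover have "U \<subseteq> Y_up L (\<Squnion>\<^bsub>L\<^esub>F)"
    unfolding a(2) S(3) Y_up_sup[OF Fc] using F(1) by blast
  ultimately show "U \<in> Y_up L ` compact_elements L"
    using k by blast
qed

text \<open>
  A basic neighbourhood of a pseudoprime \<open>p\<close> is given by a compact \<open>k \<sqsubseteq> p\<close> and finitely many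
  compact elements not below \<open>p\<close>.  Pseudoprimeness says that their meet is not below \<open>k\<close>, and a
  prime element separating the meet from \<open>k\<close> lies in the neighbourhood.
\<close>

lemma prime_elements_dense:
  assumes p: "p \<in> pseudoprime_elements L" and U: "openin (lambda_topology L) U" "p \<in> U"
  shows "\<exists>q\<in>prime_elements L. q \<in> U"
proof -
  have pc: "p \<in> carrier L" "p \<noteq> \<top>\<^bsub>L\<^esub>"
    using p by (auto simp: pseudoprime_elements_def)
  obtain k F where k: "k \<in> compact_elements L" "k \<sqsubseteq>\<^bsub>L\<^esub> p"
    and F: "finite F" "F \<subseteq> compact_elements L" "\<forall>l\<in>F. \<not> l \<sqsubseteq>\<^bsub>L\<^esub> p"
    and sub: "\<forall>x\<in>carrier L. k \<sqsubseteq>\<^bsub>L\<^esub> x \<and> (\<forall>l\<in>F. \<not> l \<sqsubseteq>\<^bsub>L\<^esub> x) \<longrightarrow> x \<in> U"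
    using lambda_basic_nbhd[OF U] by metis
  have kc: "k \<in> carrier L"
    using compact_elements_carrier[OF k(1)] .
  \<comment> \<open>adding the top element does not change the meet but excludes the empty family\<close>
  let ?F = "insert \<top>\<^bsub>L\<^esub> F"
  have Fc: "?F \<subseteq> carrier L"
    using F(2) compact_elements_carrier by auto
  have "\<not> \<top>\<^bsub>L\<^esub> \<sqsubseteq>\<^bsub>L\<^esub> p"
    using pc le_antisym[of p "\<top>\<^bsub>L\<^esub>"] by auto
  then have "\<not> \<Sqinter>\<^bsub>L\<^esub>?F \<sqsubseteq>\<^bsub>L\<^esub> k"
    using pseudoprime_elementsD[OF p _ _ Fc k(1) _ k(2)] F by auto
  then obtain q where q: "q \<in> prime_elements L" "k \<sqsubseteq>\<^bsub>L\<^esub> q" "\<not> \<Sqinter>\<^bsub>L\<^esub>?F \<sqsubseteq>\<^bsub>L\<^esub> q"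
    using prime_above_separating[OF kc inf_closed[OF Fc]] by metis
  have qc: "q \<in> carrier L"
    using prime_elements_carrier[OF q(1)] .
  have "\<not> l \<sqsubseteq>\<^bsub>L\<^esub> q" if l: "l \<in> F" for l
  proof
    assume "l \<sqsubseteq>\<^bsub>L\<^esub> q"
    moreover have "\<Sqinter>\<^bsub>L\<^esub>?F \<sqsubseteq>\<^bsub>L\<^esub> l"
      using l by (intro inf_lower[OF Fc]) simp
    ultimately show False
      using le_trans[of "\<Sqinter>\<^bsub>L\<^esub>?F" l q] q(3) qc Fc inf_closed[OF Fc] l by auto
  qed
  then show ?thesis
    using sub q qc by blast
qed

text \<open>
  By inclusion reversal, directedness says that two compact elements not below \<open>x\<close> have a compact
  lower bound not below \<open>x\<close>.  This is primeness of \<open>x\<close> tested on compact elements; nonemptiness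
  excludes the top element.
\<close>

lemma prime_iff_adm_missing_directed:
  assumes x: "x \<in> Y_carrier L"
  shows "x \<in> prime_elements L \<longleftrightarrow>
    adm_missing (Y_ob L) x \<noteq> {} \<and> directed_family (adm_missing (Y_ob L) x)"
proof -
  have xc: "x \<in> carrier L"
    using x Y_carrier_subset by blast
  have missing: "adm_missing (Y_ob L) x = Y_up L ` {k \<in> compact_elements L. \<not> k \<sqsubseteq>\<^bsub>L\<^esub> x}"
    using x by (auto simp: adm_missing_def adm_clopen_Y_ob in_Y_up_iff)
  show ?thesis
  proof
    assume prime: "x \<in> prime_elements L"
    then have "\<not> \<top>\<^bsub>L\<^esub> \<sqsubseteq>\<^bsub>L\<^esub> x"
      using xc le_antisym[of x "\<top>\<^bsub>L\<^esub>"] by (auto simp: prime_elements_def)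
    then obtain l where "l \<in> compact_elements L" "\<not> l \<sqsubseteq>\<^bsub>L\<^esub> x"
      using compact_below_not_below[OF top_closed xc] by metis
    then have "adm_missing (Y_ob L) x \<noteq> {}"
      unfolding missing by blast
    moreover have dir: "\<exists>c\<in>compact_elements L. \<not> c \<sqsubseteq>\<^bsub>L\<^esub> x \<and> Y_up L k \<subseteq> Y_up L c \<and> Y_up L l \<subseteq> Y_up L c"
      if k: "k \<in> compact_elements L" "\<not> k \<sqsubseteq>\<^bsub>L\<^esub> x" and l: "l \<in> compact_elements L" "\<not> l \<sqsubseteq>\<^bsub>L\<^esub> x" for k l
    proof -
      have kl: "k \<in> carrier L" "l \<in> carrier L"
        using k l compact_elements_carrier by auto
      have "\<not> k \<sqinter>\<^bsub>L\<^esub> l \<sqsubseteq>\<^bsub>L\<^esub> x"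
        using prime kl k(2) l(2) by (auto simp: prime_elements_def)
      then obtain c where c: "c \<in> compact_elements L" "c \<sqsubseteq>\<^bsub>L\<^esub> k \<sqinter>\<^bsub>L\<^esub> l" "\<not> c \<sqsubseteq>\<^bsub>L\<^esub> x"
        using compact_below_not_below[of "k \<sqinter>\<^bsub>L\<^esub> l" x] meet_closed[OF kl] xc by metis
      have cc: "c \<in> carrier L"
        using compact_elements_carrier[OF c(1)] .
      have "c \<sqsubseteq>\<^bsub>L\<^esub> k" "c \<sqsubseteq>\<^bsub>L\<^esub> l"
        using le_trans[OF c(2) meet_left[OF kl]] le_trans[OF c(2) meet_right[OF kl]] cc kl by simp_all
      then show ?thesis
        using c cc kl Y_up_subset_iff[of k c] Y_up_subset_iff[of l c] by blast
    qed
    have "directed_family (adm_missing (Y_ob L) x)"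
      unfolding missing directed_family_def
    proof (intro ballI)
      fix U V
      assume "U \<in> Y_up L ` {k \<in> compact_elements L. \<not> k \<sqsubseteq>\<^bsub>L\<^esub> x}"
        and "V \<in> Y_up L ` {k \<in> compact_elements L. \<not> k \<sqsubseteq>\<^bsub>L\<^esub> x}"
      then obtain k l where "k \<in> compact_elements L" "\<not> k \<sqsubseteq>\<^bsub>L\<^esub> x" "U = Y_up L k"
          "l \<in> compact_elements L" "\<not> l \<sqsubseteq>\<^bsub>L\<^esub> x" "V = Y_up L l"
        by auto
      then show "\<exists>W\<in>Y_up L ` {k \<in> compact_elements L. \<not> k \<sqsubseteq>\<^bsub>L\<^esub> x}. U \<subseteq> W \<and> V \<subseteq> W"
        using dir[of k l] by auto
    qed
    ultimately show "adm_missing (Y_ob L) x \<noteq> {} \<and> directed_family (adm_missing (Y_ob L) x)"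
      by blast
  next
    assume dir: "adm_missing (Y_ob L) x \<noteq> {} \<and> directed_family (adm_missing (Y_ob L) x)"
    then obtain l where l: "l \<in> compact_elements L" "\<not> l \<sqsubseteq>\<^bsub>L\<^esub> x"
      unfolding missing by blast
    then have top: "x \<noteq> \<top>\<^bsub>L\<^esub>"
      using compact_elements_carrier[OF l(1)] by auto
    have "a \<sqsubseteq>\<^bsub>L\<^esub> x \<or> b \<sqsubseteq>\<^bsub>L\<^esub> x"
      if ab: "a \<in> carrier L" "b \<in> carrier L" "a \<sqinter>\<^bsub>L\<^esub> b \<sqsubseteq>\<^bsub>L\<^esub> x" for a b
    proof (rule ccontr)
      assume "\<not> (a \<sqsubseteq>\<^bsub>L\<^esub> x \<or> b \<sqsubseteq>\<^bsub>L\<^esub> x)"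
      then have no: "\<not> a \<sqsubseteq>\<^bsub>L\<^esub> x" "\<not> b \<sqsubseteq>\<^bsub>L\<^esub> x"
        by auto
      obtain k where k: "k \<in> compact_elements L" "k \<sqsubseteq>\<^bsub>L\<^esub> a" "\<not> k \<sqsubseteq>\<^bsub>L\<^esub> x"
        using compact_below_not_below[OF ab(1) xc no(1)] by metis
      obtain l where l: "l \<in> compact_elements L" "l \<sqsubseteq>\<^bsub>L\<^esub> b" "\<not> l \<sqsubseteq>\<^bsub>L\<^esub> x"
        using compact_below_not_below[OF ab(2) xc no(2)] by metis
      have "Y_up L k \<in> adm_missing (Y_ob L) x" "Y_up L l \<in> adm_missing (Y_ob L) x"
        unfolding missing using k l by auto
      then obtain W where "W \<in> adm_missing (Y_ob L) x" "Y_up L k \<subseteq> W" "Y_up L l \<subseteq> W"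
        using dir unfolding directed_family_def by meson
      then obtain c where c: "c \<in> compact_elements L" "\<not> c \<sqsubseteq>\<^bsub>L\<^esub> x"
          "Y_up L k \<subseteq> Y_up L c" "Y_up L l \<subseteq> Y_up L c"
        unfolding missing by auto
      have carr: "k \<in> carrier L" "l \<in> carrier L" "c \<in> carrier L"
        using k l c compact_elements_carrier by auto
      then have "c \<sqsubseteq>\<^bsub>L\<^esub> k" "c \<sqsubseteq>\<^bsub>L\<^esub> l"
        using Y_up_subset_iff[of k c] Y_up_subset_iff[of l c] c by auto
      then have "c \<sqsubseteq>\<^bsub>L\<^esub> a" "c \<sqsubseteq>\<^bsub>L\<^esub> b"
        using le_trans[OF _ k(2), of c] le_trans[OF _ l(2), of c] carr ab by auto
      then have "c \<sqsubseteq>\<^bsub>L\<^esub> a \<sqinter>\<^bsub>L\<^esub> b"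
        using meet_le[of c a b] carr ab by simp
      then show False
        using le_trans[OF _ ab(3), of c] c(2) carr ab xc by auto
    qed
    then show "x \<in> prime_elements L"
      using xc top by (simp add: prime_elements_def)
  qed
qed

lemma Y_ob_pgps: "pointed_gen_priestley_space (Y_ob L)"
proof -
  have max: "greatest (Y_ob L) (max_pt (Y_ob L)) (carrier (Y_ob L))"
    using subsetD[OF Y_carrier_subset] by (auto simp: greatest_def Y_carrier_def)
  have sub: "dist_pts (Y_ob L) \<subseteq> carrier (Y_ob L) - {max_pt (Y_ob L)}"
    using dist_pts_Y_ob by (auto simp: prime_elements_def)
  have dense: "subtopology (topo (Y_ob L)) (carrier (Y_ob L) - {max_pt (Y_ob L)}) closure_of dist_pts (Y_ob L)
      = carrier (Y_ob L) - {max_pt (Y_ob L)}" (is "?T closure_of _ = ?Z")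
  proof -
    have top: "topspace ?T = ?Z"
      using Y_carrier_subset by (auto simp: topspace_lambda)
    have "p \<in> ?T closure_of dist_pts (Y_ob L)" if p: "p \<in> ?Z" for p
    proof -
      have pp: "p \<in> pseudoprime_elements L"
        using p by (auto simp: Y_carrier_def)
      have "\<exists>q. q \<in> dist_pts (Y_ob L) \<and> q \<in> V" if V: "p \<in> V" "openin ?T V" for V
      proof -
        obtain W where W: "openin (lambda_topology L) W" "V = W \<inter> (Y_carrier L \<inter> ?Z)"
          using V(2) by (auto simp: subtopology_subtopology openin_subtopology)
        then obtain q where "q \<in> prime_elements L" "q \<in> W"
          using prime_elements_dense[OF pp W(1)] V(1) by auto
        then show ?thesis
          using W(2) sub by auto
      qed
      then show ?thesis
        unfolding in_closure_of using p top by blast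
    qed
    then show ?thesis
      using closure_of_subset_topspace[of ?T "dist_pts (Y_ob L)"] top by blast
  qed
  have above: "\<exists>y\<in>dist_pts (Y_ob L). x \<sqsubseteq>\<^bsub>Y_ob L\<^esub> y" if x: "x \<in> carrier (Y_ob L) - {max_pt (Y_ob L)}" for x
  proof -
    have xc: "x \<in> carrier L" "x \<noteq> \<top>\<^bsub>L\<^esub>"
      using x Y_carrier_subset by auto
    then have "\<not> \<top>\<^bsub>L\<^esub> \<sqsubseteq>\<^bsub>L\<^esub> x"
      using le_antisym[of x "\<top>\<^bsub>L\<^esub>"] by auto
    then obtain q where "q \<in> prime_elements L" "x \<sqsubseteq>\<^bsub>L\<^esub> q"
      using prime_above_separating[OF xc(1) top_closed] by metis
    then show ?thesis
      by auto
  qed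
  have le: "x \<sqsubseteq>\<^bsub>Y_ob L\<^esub> y \<longleftrightarrow> (\<forall>U\<in>adm_clopen (Y_ob L). x \<in> U \<longrightarrow> y \<in> U)"
    if xy: "x \<in> carrier (Y_ob L)" "y \<in> carrier (Y_ob L)" for x y
  proof
    assume "x \<sqsubseteq>\<^bsub>Y_ob L\<^esub> y"
    then show "\<forall>U\<in>adm_clopen (Y_ob L). x \<in> U \<longrightarrow> y \<in> U"
      using upsetD[OF clopen_upsetD(3)[OF adm_clopenD[where X="Y_ob L"]]] xy(2) by blast
  next
    assume *: "\<forall>U\<in>adm_clopen (Y_ob L). x \<in> U \<longrightarrow> y \<in> U"
    show "x \<sqsubseteq>\<^bsub>Y_ob L\<^esub> y"
    proof (rule ccontr)
      assume no: "\<not> x \<sqsubseteq>\<^bsub>Y_ob L\<^esub> y"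
      have "x \<in> carrier L" "y \<in> carrier L"
        using xy Y_carrier_subset by auto
      then obtain k where "k \<in> compact_elements L" "k \<sqsubseteq>\<^bsub>L\<^esub> x" "\<not> k \<sqsubseteq>\<^bsub>L\<^esub> y"
        using compact_below_not_below[OF _ _ no[unfolded Y_ob_simps]] by metis
      then show False
        using * xy by (auto simp: adm_clopen_Y_ob in_Y_up_iff)
    qed
  qed
  show ?thesis
    by (intro pointed_gen_priestley_space.intro pointed_gen_priestley_space_axioms.intro
        Y_ob_priestley max sub dense above le)
       (use prime_iff_adm_missing_directed in simp_all)
qed

end


section \<open>The functor from frames to spaces\<close>

text \<open>
  With \<open>r\<close> the right adjoint of \<open>\<alpha>\<close>, the condition \<open>a \<sqsubseteq> r p\<close> may be tested on the primes above
  \<open>r p\<close>, and it is equivalent to \<open>\<alpha> a \<sqsubseteq> p\<close>.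
\<close>

lemma box_Y_mor:
  assumes \<alpha>: "\<alpha> \<in> frm_hom L M" and a: "a \<in> carrier L"
  shows "box (Y_ob M) (Y_mor L M \<alpha>) (Y_up L a) = Y_up M (\<alpha> a)"
proof -
  interpret L: algebraic_frame L by (rule frm_homD(1)[OF \<alpha>])
  interpret M: algebraic_frame M by (rule frm_homD(2)[OF \<alpha>])
  note inY = in_Y_up_iff[OF frm_homD(1)[OF \<alpha>]]
  let ?r = "right_adjoint L M \<alpha>"
  have "p \<in> box (Y_ob M) (Y_mor L M \<alpha>) (Y_up L a) \<longleftrightarrow> \<alpha> a \<sqsubseteq>\<^bsub>M\<^esub> p" if p: "p \<in> Y_carrier M" for p
  proof -
    have pc: "p \<in> carrier M"
      using p M.Y_carrier_subset by blast
    have rp: "?r p \<in> carrier L"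
      by (rule right_adjoint_closed[OF \<alpha> pc])
    have "p \<in> box (Y_ob M) (Y_mor L M \<alpha>) (Y_up L a)
        \<longleftrightarrow> (\<forall>q\<in>Y_carrier L. ?r p \<sqsubseteq>\<^bsub>L\<^esub> q \<longrightarrow> a \<sqsubseteq>\<^bsub>L\<^esub> q)"
      using p by (auto simp: in_box_iff Y_mor_def inY)
    also have "\<dots> \<longleftrightarrow> a \<sqsubseteq>\<^bsub>L\<^esub> ?r p"
    proof
      assume "\<forall>q\<in>Y_carrier L. ?r p \<sqsubseteq>\<^bsub>L\<^esub> q \<longrightarrow> a \<sqsubseteq>\<^bsub>L\<^esub> q"
      then show "a \<sqsubseteq>\<^bsub>L\<^esub> ?r p"
        using L.le_iff_primes[OF a rp] L.prime_in_Y_carrier by simp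
    next
      assume ar: "a \<sqsubseteq>\<^bsub>L\<^esub> ?r p"
      show "\<forall>q\<in>Y_carrier L. ?r p \<sqsubseteq>\<^bsub>L\<^esub> q \<longrightarrow> a \<sqsubseteq>\<^bsub>L\<^esub> q"
        using L.le_trans[OF ar _ a rp] L.Y_carrier_subset by auto
    qed
    also have "\<dots> \<longleftrightarrow> \<alpha> a \<sqsubseteq>\<^bsub>M\<^esub> p"
      by (rule right_adjoint_iff[OF \<alpha> a pc])
    finally show ?thesis .
  qed
  then show ?thesis
    by (auto simp: in_Y_up_iff[OF frm_homD(2)[OF \<alpha>]]) (auto simp: in_box_iff)
qed

lemma Y_mor_hom:
  assumes \<alpha>: "\<alpha> \<in> frm_hom L M"
  shows "Y_mor L M \<alpha> \<in> pgps_hom (Y_ob M) (Y_ob L)"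
proof (rule pgps_homI)
  note L = frm_homD(1)[OF \<alpha>] and M = frm_homD(2)[OF \<alpha>]
  interpret L: algebraic_frame L by (rule L)
  interpret M: algebraic_frame M by (rule M)
  show "pointed_gen_priestley_space (Y_ob M)" "pointed_gen_priestley_space (Y_ob L)"
    by (rule Y_ob_pgps[OF M] Y_ob_pgps[OF L])+
  show "Y_mor L M \<alpha> \<subseteq> carrier (Y_ob M) \<times> carrier (Y_ob L)"
    by (auto simp: Y_mor_def)
  show "box (Y_ob M) (Y_mor L M \<alpha>) U \<in> adm_clopen (Y_ob M)" if "U \<in> adm_clopen (Y_ob L)" for U
    using that box_Y_mor[OF \<alpha> L.compact_elements_carrier] frm_homD(6)[OF \<alpha>]
    by (auto simp: adm_clopen_Y_ob[OF L] adm_clopen_Y_ob[OF M])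
  show "(p, q) \<in> Y_mor L M \<alpha>" if pq: "p \<in> carrier (Y_ob M)" "q \<in> carrier (Y_ob L)"
    and *: "\<And>U. \<lbrakk>U \<in> adm_clopen (Y_ob L); p \<in> box (Y_ob M) (Y_mor L M \<alpha>) U\<rbrakk> \<Longrightarrow> q \<in> U" for p q
  proof (rule ccontr)
    assume "(p, q) \<notin> Y_mor L M \<alpha>"
    then have no: "\<not> right_adjoint L M \<alpha> p \<sqsubseteq>\<^bsub>L\<^esub> q"
      using pq by (simp add: Y_mor_def)
    have carr: "p \<in> carrier M" "q \<in> carrier L"
      using pq L.Y_carrier_subset M.Y_carrier_subset by auto
    obtain k where k: "k \<in> compact_elements L" "k \<sqsubseteq>\<^bsub>L\<^esub> right_adjoint L M \<alpha> p" "\<not> k \<sqsubseteq>\<^bsub>L\<^esub> q"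
      using L.compact_below_not_below[OF right_adjoint_closed[OF \<alpha> carr(1)] carr(2) no] by metis
    have kc: "k \<in> carrier L"
      by (rule L.compact_elements_carrier[OF k(1)])
    have "\<alpha> k \<sqsubseteq>\<^bsub>M\<^esub> p"
      using right_adjoint_iff[OF \<alpha> kc carr(1)] k(2) by simp
    then have "p \<in> box (Y_ob M) (Y_mor L M \<alpha>) (Y_up L k)"
      using pq by (simp add: box_Y_mor[OF \<alpha> kc] in_Y_up_iff[OF M])
    moreover have "Y_up L k \<in> adm_clopen (Y_ob L)"
      using k(1) by (simp add: adm_clopen_Y_ob[OF L])
    ultimately have "q \<in> Y_up L k"
      by (intro *)
    then show False
      using k(3) by (simp add: in_Y_up_iff[OF L])
  qed
qed

text \<open>
  \<open>\<Y>(\<alpha>)\<close> is the only morphism whose box acts as \<open>\<alpha>\<close> on compact elements, which characterises it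
  without reference to right adjoints.
\<close>

lemma Y_mor_eqI:
  assumes \<alpha>: "\<alpha> \<in> frm_hom L M" and R: "R \<in> pgps_hom (Y_ob M) (Y_ob L)"
    and box: "\<And>k. k \<in> compact_elements L \<Longrightarrow> box (Y_ob M) R (Y_up L k) = Y_up M (\<alpha> k)"
  shows "Y_mor L M \<alpha> = R"
proof (rule pgps_hom_eqI[OF Y_mor_hom[OF \<alpha>] R])
  interpret L: algebraic_frame L by (rule frm_homD(1)[OF \<alpha>])
  fix U assume "U \<in> adm_clopen (Y_ob L)"
  then obtain k where k: "k \<in> compact_elements L" "U = Y_up L k"
    by (auto simp: adm_clopen_Y_ob[OF frm_homD(1)[OF \<alpha>]])
  then show "box (Y_ob M) (Y_mor L M \<alpha>) U = box (Y_ob M) R U"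
    using box[OF k(1)] box_Y_mor[OF \<alpha> L.compact_elements_carrier[OF k(1)]] by simp
qed

lemma Y_mor_id:
  assumes L: "algebraic_frame L"
  shows "Y_mor L L (frm_id L) = pgps_id (Y_ob L)"
proof (rule Y_mor_eqI[OF frm_id_hom[OF L] pgps_id_hom[OF Y_ob_pgps[OF L]]])
  interpret L: algebraic_frame L by (rule L)
  fix k assume k: "k \<in> compact_elements L"
  then have "Y_up L k \<in> adm_clopen (Y_ob L)"
    by (simp add: adm_clopen_Y_ob[OF L])
  then show "box (Y_ob L) (pgps_id (Y_ob L)) (Y_up L k) = Y_up L (frm_id L k)"
    using box_pgps_id_adm_clopen[OF Y_ob_pgps[OF L]] L.compact_elements_carrier[OF k]
    by (simp add: frm_id_def)
qed

lemma Y_mor_comp: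
  assumes \<alpha>: "\<alpha> \<in> frm_hom L M" and \<beta>: "\<beta> \<in> frm_hom M N"
  shows "Y_mor L N (frm_comp L \<beta> \<alpha>)
    = pgps_comp (Y_ob N) (Y_ob M) (Y_ob L) (Y_mor L M \<alpha>) (Y_mor M N \<beta>)"
proof (rule Y_mor_eqI[OF frm_comp_hom[OF \<alpha> \<beta>] pgps_comp_hom[OF Y_mor_hom[OF \<beta>] Y_mor_hom[OF \<alpha>]]])
  interpret L: algebraic_frame L by (rule frm_homD(1)[OF \<alpha>])
  fix k assume k: "k \<in> compact_elements L"
  have kc: "k \<in> carrier L"
    by (rule L.compact_elements_carrier[OF k])
  have "Y_up L k \<in> adm_clopen (Y_ob L)"
    using k by (simp add: adm_clopen_Y_ob[OF frm_homD(1)[OF \<alpha>]])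
  then have "box (Y_ob N) (pgps_comp (Y_ob N) (Y_ob M) (Y_ob L) (Y_mor L M \<alpha>) (Y_mor M N \<beta>)) (Y_up L k)
      = box (Y_ob N) (Y_mor M N \<beta>) (box (Y_ob M) (Y_mor L M \<alpha>) (Y_up L k))"
    by (rule box_pgps_comp[OF pgps_homD(1)[OF Y_mor_hom[OF \<beta>]] pgps_homD(1)[OF Y_mor_hom[OF \<alpha>]]])
  also have "\<dots> = Y_up N (\<beta> (\<alpha> k))"
    by (simp add: box_Y_mor[OF \<alpha> kc] box_Y_mor[OF \<beta> frm_homD(4)[OF \<alpha> kc]])
  finally show "box (Y_ob N) (pgps_comp (Y_ob N) (Y_ob M) (Y_ob L) (Y_mor L M \<alpha>) (Y_mor M N \<beta>)) (Y_up L k)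
      = Y_up N (frm_comp L \<beta> \<alpha> k)"
    using kc by (simp add: frm_comp_def compose_def)
qed


section \<open>The natural isomorphism on frames\<close>

lemma frm_unit_apply: "a \<in> carrier L \<Longrightarrow> frm_unit L a = Y_up L a"
  by (simp add: frm_unit_def Y_up_def)

lemma frm_unit_iso:
  assumes L: "algebraic_frame L"
  shows "frm_unit L \<in> frm_iso L (V_ob (Y_ob L))"
proof (rule order_iso_frm_iso[OF L])
  interpret L: algebraic_frame L by (rule L)
  show "algebraic_frame (V_ob (Y_ob L))"
    by (rule pointed_gen_priestley_space.V_ob_algebraic_frame[OF Y_ob_pgps[OF L]])
  have im: "Y_up L a \<in> adm_closed (Y_ob L)" if "a \<in> carrier L" for a
    using Y_up_adm_closed[OF L that] .
  show "frm_unit L \<in> carrier L \<rightarrow>\<^sub>E carrier (V_ob (Y_ob L))"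
    using im by (simp add: frm_unit_def Y_up_def)
  have le: "Y_up L a \<subseteq> Y_up L b \<longleftrightarrow> b \<sqsubseteq>\<^bsub>L\<^esub> a" if "a \<in> carrier L" "b \<in> carrier L" for a b
    using Y_up_subset_iff[OF L that] .
  show "frm_unit L a \<sqsubseteq>\<^bsub>V_ob (Y_ob L)\<^esub> frm_unit L b \<longleftrightarrow> a \<sqsubseteq>\<^bsub>L\<^esub> b" if "a \<in> carrier L" "b \<in> carrier L" for a b
    using that le by (simp add: frm_unit_apply)
  show "bij_betw (frm_unit L) (carrier L) (carrier (V_ob (Y_ob L)))"
    unfolding bij_betw_def
  proof (intro conjI inj_onI equalityI subsetI)
    fix a b assume ab: "a \<in> carrier L" "b \<in> carrier L" "frm_unit L a = frm_unit L b"
    then have "a \<sqsubseteq>\<^bsub>L\<^esub> b" "b \<sqsubseteq>\<^bsub>L\<^esub> a"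
      using le[of a b] le[of b a] by (auto simp: frm_unit_apply)
    then show "a = b"
      using ab by (intro L.le_antisym)
  next
    fix C assume "C \<in> frm_unit L ` carrier L"
    then show "C \<in> carrier (V_ob (Y_ob L))"
      using im by (auto simp: frm_unit_apply)
  next
    fix C assume "C \<in> carrier (V_ob (Y_ob L))"
    then obtain a where "a \<in> carrier L" "C = Y_up L a"
      using adm_closed_eq_Y_up[OF L, of C] by auto
    then show "C \<in> frm_unit L ` carrier L"
      by (auto simp: frm_unit_apply)
  qed
qed

lemma frm_unit_natural:
  assumes \<alpha>: "\<alpha> \<in> frm_hom L M"
  shows "frm_comp L (V_mor (Y_ob M) (Y_ob L) (Y_mor L M \<alpha>)) (frm_unit L) = frm_comp L (frm_unit M) \<alpha>"
  using Y_up_adm_closed[OF frm_homD(1)[OF \<alpha>]] box_Y_mor[OF \<alpha>] frm_homD(4)[OF \<alpha>]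
  by (auto simp: frm_comp_def compose_def restrict_def fun_eq_iff V_mor_def frm_unit_def Y_up_def)


section \<open>The natural isomorphism on spaces\<close>

context pointed_gen_priestley_space
begin

lemma max_pt_in_adm_closed:
  assumes "C \<in> adm_closed X"
  shows "max_pt X \<in> C"
proof -
  have "max_pt X \<in> carrier X"
    using max_pt_greatest by (auto simp: greatest_def)
  then have "max_pt X \<in> carrier X \<inter> \<Inter>{U \<in> adm_clopen X. C \<subseteq> U}"
    using max_pt_in_adm_clopen by blast
  then show ?thesis
    using adm_closed_eq_Inter[OF assms] by metis
qed

text \<open>
  The top element is the smallest admissible closed set, and every admissible closed set contains \<open>m\<close>.
\<close>

lemma top_V_ob: "\<top>\<^bsub>V_ob X\<^esub> = principal_up X (max_pt X)"
proof -
  interpret V: complete_lattice "V_ob X" by (rule V_ob_complete_lattice)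
  have m: "max_pt X \<in> carrier X" "\<forall>x\<in>carrier X. x \<sqsubseteq> max_pt X"
    using max_pt_greatest by (auto simp: greatest_def)
  have sing: "principal_up X (max_pt X) = {max_pt X}"
    using m le_antisym by (auto simp: principal_up_def)
  have "\<top>\<^bsub>V_ob X\<^esub> \<subseteq> principal_up X (max_pt X)"
    using V.top_higher[of "principal_up X (max_pt X)"] principal_up_adm_closed[OF m(1)] by simp
  moreover have "max_pt X \<in> \<top>\<^bsub>V_ob X\<^esub>"
    using max_pt_in_adm_closed V.top_closed by simp
  ultimately show ?thesis
    using sing by auto
qed

lemma dist_pts_meet_open:
  assumes "openin (topo X) N" "x \<in> N" "x \<noteq> max_pt X"
  shows "\<exists>y\<in>dist_pts X. y \<in> N"
proof -
  let ?T = "subtopology (topo X) (carrier X - {max_pt X})"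
  have "x \<in> carrier X"
    using openin_subset[OF assms(1)] assms(2) topspace_topo by auto
  then have cl: "x \<in> ?T closure_of dist_pts X" and x: "x \<in> N \<inter> (carrier X - {max_pt X})"
    using dist_pts_dense assms(2,3) by simp_all
  have N: "openin ?T (N \<inter> (carrier X - {max_pt X}))"
    using assms(1) by (auto simp: openin_subtopology)
  have "\<exists>y. y \<in> dist_pts X \<and> y \<in> N \<inter> (carrier X - {max_pt X})"
    using mp[OF spec[OF conjunct2[OF iffD1[OF in_closure_of cl]]] conjI[OF x N]] .
  then show ?thesis
    by blast
qed

text \<open>
  If \<open>x\<close> lies in an admissible clopen set \<open>U\<close> contained in a finite meet of admissible closed sets
  but in none of these, then the points of \<open>U\<close> outside all of them form a neighbourhood of \<open>x\<close>.  By
  density it meets \<open>X\<^sub>0\<close>, where the meet is the union.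
\<close>

lemma principal_up_in_Y_carrier:
  assumes x: "x \<in> carrier X"
  shows "principal_up X x \<in> Y_carrier (V_ob X)"
proof (cases "x = max_pt X")
  case True
  then show ?thesis
    by (simp add: Y_carrier_def top_V_ob)
next
  case False
  interpret V: algebraic_frame "V_ob X" by (rule V_ob_algebraic_frame)
  have m: "max_pt X \<in> carrier X" "x \<sqsubseteq> max_pt X"
    using max_pt_greatest x by (auto simp: greatest_def)
  have "principal_up X x \<in> pseudoprime_elements (V_ob X)"
  proof (rule V.pseudoprime_elementsI)
    show "principal_up X x \<in> carrier (V_ob X)"
      using principal_up_adm_closed[OF x] by simp
    have "x \<in> principal_up X x" "x \<notin> principal_up X (max_pt X)"
      using x m False le_antisym[of x "max_pt X"] by (auto simp: principal_up_def)
    then show "principal_up X x \<noteq> \<top>\<^bsub>V_ob X\<^esub>"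
      unfolding top_V_ob by blast
    fix \<F> U
    assume \<F>: "finite \<F>" "\<F> \<noteq> {}" "\<F> \<subseteq> compact_elements (V_ob X)"
      and "U \<in> compact_elements (V_ob X)"
      and U: "\<Sqinter>\<^bsub>V_ob X\<^esub>\<F> \<sqsubseteq>\<^bsub>V_ob X\<^esub> U" "U \<sqsubseteq>\<^bsub>V_ob X\<^esub> principal_up X x"
    then have UA: "U \<in> adm_clopen X" and \<F>A: "\<F> \<subseteq> adm_clopen X"
      unfolding V_ob_compact_elements by auto
    have \<F>C: "\<F> \<subseteq> adm_closed X"
      using \<F>A adm_clopen_closed by blast
    have xU: "x \<in> U"
      using U(2) x by (auto simp: principal_up_def)
    have "x \<in> \<Union>\<F>"
    proof (rule ccontr)
      assume no: "x \<notin> \<Union>\<F>"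
      have "openin (topo X) (U - \<Union>\<F>)"
        using \<F>(1) \<F>C clopen_upsetD(1)[OF adm_clopenD[OF UA]] adm_closedD(1)[where X=X]
        by (intro openin_diff closedin_Union) auto
      then obtain y where y: "y \<in> dist_pts X" "y \<in> U - \<Union>\<F>"
        using dist_pts_meet_open[of "U - \<Union>\<F>" x] xU no False by auto
      then have "y \<in> dist_pts X \<inter> \<Sqinter>\<^bsub>V_ob X\<^esub>\<F>"
        using U(1) by auto
      then show False
        unfolding V_ob_finite_inf_trace[OF \<F>(1) \<F>C] using y by blast
    qed
    then obtain C where C: "C \<in> \<F>" "x \<in> C"
      by blast
    then have "upset X C"
      using adm_closedD(2)[of C X] \<F>C by auto
    then have "principal_up X x \<subseteq> C"
      using C(2) by (auto simp: principal_up_def upset_def)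
    then show "\<exists>C\<in>\<F>. C \<sqsubseteq>\<^bsub>V_ob X\<^esub> principal_up X x"
      using C(1) by auto
  qed
  then show ?thesis
    by (simp add: Y_carrier_def)
qed

end

lemma adm_clopen_Y_V:
  assumes X: "pointed_gen_priestley_space X"
  shows "adm_clopen (Y_ob (V_ob X)) = Y_up (V_ob X) ` adm_clopen X"
  using adm_clopen_Y_ob[OF pointed_gen_priestley_space.V_ob_algebraic_frame[OF X]]
    pointed_gen_priestley_space.V_ob_compact_elements[OF X] by simp

lemma in_Y_up_V_iff:
  assumes X: "pointed_gen_priestley_space X"
  shows "C \<in> Y_up (V_ob X) U \<longleftrightarrow> C \<in> Y_carrier (V_ob X) \<and> C \<subseteq> U"
  using in_Y_up_iff[OF pointed_gen_priestley_space.V_ob_algebraic_frame[OF X]] by simp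

text \<open>
  An upset contains \<open>x\<close> iff it contains \<open>\<up>x\<close>, and \<open>\<up>x\<close> is the least of the points that the unit
  relates to \<open>x\<close>.
\<close>

lemma box_pgps_unit:
  assumes X: "pointed_gen_priestley_space X" and U: "upset X U"
  shows "box X (pgps_unit X) (Y_up (V_ob X) U) = U"
proof -
  interpret pointed_gen_priestley_space X by (rule X)
  show ?thesis
  proof (intro equalityI subsetI)
    fix x assume x: "x \<in> box X (pgps_unit X) (Y_up (V_ob X) U)"
    then have xc: "x \<in> carrier X"
      by (simp add: in_box_iff)
    have "(x, principal_up X x) \<in> pgps_unit X"
      using xc principal_up_in_Y_carrier[OF xc] by (simp add: pgps_unit_def)
    then have "principal_up X x \<subseteq> U"
      using x by (simp add: in_box_iff in_Y_up_V_iff[OF X])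
    then show "x \<in> U"
      using xc by (auto simp: principal_up_def)
  next
    fix x assume x: "x \<in> U"
    then have "principal_up X x \<subseteq> U"
      using U by (auto simp: upset_def principal_up_def)
    then show "x \<in> box X (pgps_unit X) (Y_up (V_ob X) U)"
      using x U by (auto simp: in_box_iff in_Y_up_V_iff[OF X] pgps_unit_def upset_def)
  qed
qed

lemma pgps_unit_hom:
  assumes X: "pointed_gen_priestley_space X"
  shows "pgps_unit X \<in> pgps_hom X (Y_ob (V_ob X))"
proof (rule pgps_homI[OF X Y_ob_pgps])
  interpret pointed_gen_priestley_space X by (rule X)
  interpret V: algebraic_frame "V_ob X" by (rule V_ob_algebraic_frame)
  show "algebraic_frame (V_ob X)"
    by (rule V_ob_algebraic_frame)
  show "pgps_unit X \<subseteq> carrier X \<times> carrier (Y_ob (V_ob X))"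
    by (auto simp: pgps_unit_def)
  note box = box_pgps_unit[OF X clopen_upsetD(3)[OF adm_clopenD]]
  show "box X (pgps_unit X) U \<in> adm_clopen X" if "U \<in> adm_clopen (Y_ob (V_ob X))" for U
    using that box by (auto simp: adm_clopen_Y_V[OF X])
  show "(x, C) \<in> pgps_unit X" if x: "x \<in> carrier X" and C: "C \<in> carrier (Y_ob (V_ob X))"
    and *: "\<And>U. \<lbrakk>U \<in> adm_clopen (Y_ob (V_ob X)); x \<in> box X (pgps_unit X) U\<rbrakk> \<Longrightarrow> C \<in> U" for x C
  proof -
    have CU: "C \<subseteq> U" if "U \<in> adm_clopen X" "x \<in> U" for U
      using *[of "Y_up (V_ob X) U"] that box[OF that(1)]
      by (simp add: adm_clopen_Y_V[OF X] in_Y_up_V_iff[OF X])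
    have Cc: "C \<subseteq> carrier X"
      using CU[OF carrier_adm_clopen] x by blast
    have "C \<subseteq> principal_up X x"
    proof
      fix c assume c: "c \<in> C"
      then have cc: "c \<in> carrier X"
        using Cc by blast
      have "x \<sqsubseteq>\<^bsub>X\<^esub> c"
        using le_iff_adm[OF x cc] CU c by blast
      then show "c \<in> principal_up X x"
        using cc by (simp add: principal_up_def)
    qed
    then show ?thesis
      using x C by (simp add: pgps_unit_def)
  qed
qed

text \<open>
  The inverse relates \<open>C\<close> to its elements.  The box of the unit sends \<open>\<up>U\<close> to \<open>U\<close> and the box of the
  inverse sends \<open>U\<close> to \<open>\<up>U\<close>; these maps between the admissible clopen upsets are mutually inverse,
  hence so are the relations.
\<close>

lemma pgps_unit_iso:
  assumes X: "pointed_gen_priestley_space X"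
  shows "pgps_unit X \<in> pgps_iso X (Y_ob (V_ob X))"
proof -
  interpret pointed_gen_priestley_space X by (rule X)
  interpret V: algebraic_frame "V_ob X" by (rule V_ob_algebraic_frame)
  define S where "S = {(C, x). C \<in> Y_carrier (V_ob X) \<and> x \<in> C}"
  have YC: "C \<in> adm_closed X" if "C \<in> Y_carrier (V_ob X)" for C
    using that V.Y_carrier_subset by auto
  have sub: "S \<subseteq> carrier (Y_ob (V_ob X)) \<times> carrier X"
    using YC adm_closedD(3)[where X=X] by (auto simp: S_def)
  have boxS: "box (Y_ob (V_ob X)) S U = Y_up (V_ob X) U" for U
    by (auto simp: in_box_iff S_def in_Y_up_V_iff[OF X])
  have boxR: "box X (pgps_unit X) (Y_up (V_ob X) U) = U" if "U \<in> adm_clopen X" for U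
    using box_pgps_unit[OF X clopen_upsetD(3)[OF adm_clopenD[OF that]]] .
  note Y = Y_ob_pgps[OF V_ob_algebraic_frame]
  note R = pgps_unit_hom[OF X]
  have S: "S \<in> pgps_hom (Y_ob (V_ob X)) X"
  proof (rule pgps_homI[OF Y X sub])
    show "box (Y_ob (V_ob X)) S U \<in> adm_clopen (Y_ob (V_ob X))" if "U \<in> adm_clopen X" for U
      using that by (simp add: boxS adm_clopen_Y_V[OF X])
    fix C x assume C: "C \<in> carrier (Y_ob (V_ob X))" and x: "x \<in> carrier X"
      and *: "\<And>U. \<lbrakk>U \<in> adm_clopen X; C \<in> box (Y_ob (V_ob X)) S U\<rbrakk> \<Longrightarrow> x \<in> U"
    have CA: "C \<in> adm_closed X"
      using YC C by simp
    have "x \<in> U" if "U \<in> adm_clopen X" "C \<subseteq> U" for U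
      using *[OF that(1)] that(2) C by (simp add: boxS in_Y_up_V_iff[OF X])
    then have "x \<in> carrier X \<inter> \<Inter>{U \<in> adm_clopen X. C \<subseteq> U}"
      using x by simp
    then have "x \<in> C"
      using adm_closed_eq_Inter[OF CA] by metis
    then show "(C, x) \<in> S"
      using C by (simp add: S_def)
  qed
  have "pgps_comp X (Y_ob (V_ob X)) X S (pgps_unit X) = pgps_id X"
  proof (rule pgps_hom_eqI[OF pgps_comp_hom[OF R S] pgps_id_hom[OF X]])
    fix U assume U: "U \<in> adm_clopen X"
    show "box X (pgps_comp X (Y_ob (V_ob X)) X S (pgps_unit X)) U = box X (pgps_id X) U"
      using box_pgps_comp[OF pgps_homD(1)[OF R] sub U] boxR[OF U]
        box_pgps_id_adm_clopen[OF X U] by (simp add: boxS)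
  qed
  moreover have "pgps_comp (Y_ob (V_ob X)) X (Y_ob (V_ob X)) (pgps_unit X) S = pgps_id (Y_ob (V_ob X))"
  proof (rule pgps_hom_eqI[OF pgps_comp_hom[OF S R] pgps_id_hom[OF Y]])
    fix W assume W: "W \<in> adm_clopen (Y_ob (V_ob X))"
    then obtain U where U: "U \<in> adm_clopen X" "W = Y_up (V_ob X) U"
      by (auto simp: adm_clopen_Y_V[OF X])
    show "box (Y_ob (V_ob X)) (pgps_comp (Y_ob (V_ob X)) X (Y_ob (V_ob X)) (pgps_unit X) S) W
        = box (Y_ob (V_ob X)) (pgps_id (Y_ob (V_ob X))) W"
      using box_pgps_comp[OF sub pgps_homD(1)[OF R] W] boxR[OF U(1)]
        box_pgps_id_adm_clopen[OF Y W] U(2) by (simp add: boxS)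
  qed
  ultimately show ?thesis
    using R S unfolding pgps_iso_def by blast
qed

text \<open>
  The boxes of both composites send \<open>\<up>U\<close> to \<open>\<box>\<^sub>R U\<close>.
\<close>

lemma pgps_unit_natural:
  assumes R: "R \<in> pgps_hom X Y"
  shows "pgps_comp X (Y_ob (V_ob X)) (Y_ob (V_ob Y))
          (Y_mor (V_ob Y) (V_ob X) (V_mor X Y R)) (pgps_unit X)
        = pgps_comp X Y (Y_ob (V_ob Y)) (pgps_unit Y) R"
proof -
  note X = pgps_homD(2)[OF R] and Y = pgps_homD(3)[OF R]
  interpret X: pointed_gen_priestley_space X by (rule X)
  interpret Y: pointed_gen_priestley_space Y by (rule Y)
  note V = V_mor_hom[OF R]
  note uX = pgps_unit_hom[OF X] and uY = pgps_unit_hom[OF Y]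
  note YV = Y_mor_hom[OF V]
  show ?thesis
  proof (rule pgps_hom_eqI[OF pgps_comp_hom[OF uX YV] pgps_comp_hom[OF R uY]])
    fix W assume W: "W \<in> adm_clopen (Y_ob (V_ob Y))"
    then obtain U where U: "U \<in> adm_clopen Y" "W = Y_up (V_ob Y) U"
      by (auto simp: adm_clopen_Y_V[OF Y])
    have UC: "U \<in> carrier (V_ob Y)"
      using Y.adm_clopen_closed[OF U(1)] by simp
    have "box (Y_ob (V_ob X)) (Y_mor (V_ob Y) (V_ob X) (V_mor X Y R)) W = Y_up (V_ob X) (box X R U)"
      unfolding U(2) box_Y_mor[OF V UC] using UC by (simp add: V_mor_def)
    moreover have "box X (pgps_unit X) (Y_up (V_ob X) (box X R U)) = box X R U"
      using box_pgps_unit[OF X clopen_upsetD(3)[OF adm_clopenD[OF pgps_homD(4)[OF R U(1)]]]] .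
    moreover have "box Y (pgps_unit Y) W = U"
      unfolding U(2) using box_pgps_unit[OF Y clopen_upsetD(3)[OF adm_clopenD[OF U(1)]]] .
    ultimately show "box X (pgps_comp X (Y_ob (V_ob X)) (Y_ob (V_ob Y))
          (Y_mor (V_ob Y) (V_ob X) (V_mor X Y R)) (pgps_unit X)) W
        = box X (pgps_comp X Y (Y_ob (V_ob Y)) (pgps_unit Y) R) W"
      using box_pgps_comp[OF pgps_homD(1)[OF uX] pgps_homD(1)[OF YV] W]
        box_pgps_comp[OF pgps_homD(1)[OF R] pgps_homD(1)[OF uY] W] by simp
  qed
qed


section \<open>The dual equivalence\<close>

theorem theorem4p29:
  shows
  \<comment> \<open>algebraic frames with their morphisms form a category\<close>
  "(\<forall>L :: 'a gorder. algebraic_frame L \<longrightarrow> frm_id L \<in> frm_hom L L) \<and>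
   (\<forall>(L :: 'a gorder) (M :: 'b gorder) (N :: 'c gorder). \<forall>\<alpha> \<in> frm_hom L M. \<forall>\<beta> \<in> frm_hom M N.
      frm_comp L \<beta> \<alpha> \<in> frm_hom L N) \<and>
   (\<forall>(L :: 'a gorder) (M :: 'b gorder). \<forall>\<alpha> \<in> frm_hom L M.
      frm_comp L \<alpha> (frm_id L) = \<alpha> \<and> frm_comp L (frm_id M) \<alpha> = \<alpha>) \<and>
   (\<forall>(L :: 'a gorder) (M :: 'b gorder) (N :: 'c gorder) (P :: 'd gorder).
      \<forall>\<alpha> \<in> frm_hom L M. \<forall>\<beta> \<in> frm_hom M N. \<forall>\<gamma> \<in> frm_hom N P.
      frm_comp L \<gamma> (frm_comp L \<beta> \<alpha>) = frm_comp L (frm_comp M \<gamma> \<beta>) \<alpha>) \<and>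

   \<comment> \<open>pointed generalized Priestley spaces with their morphisms form a category\<close>
   (\<forall>X :: 'a pospace. pointed_gen_priestley_space X \<longrightarrow> pgps_id X \<in> pgps_hom X X) \<and>
   (\<forall>(X :: 'a pospace) (Y :: 'b pospace) (Z :: 'c pospace). \<forall>R \<in> pgps_hom X Y. \<forall>S \<in> pgps_hom Y Z.
      pgps_comp X Y Z S R \<in> pgps_hom X Z) \<and>
   (\<forall>(X :: 'a pospace) (Y :: 'b pospace). \<forall>R \<in> pgps_hom X Y.
      pgps_comp X X Y R (pgps_id X) = R \<and> pgps_comp X Y Y (pgps_id Y) R = R) \<and>
   (\<forall>(X :: 'a pospace) (Y :: 'b pospace) (Z :: 'c pospace) (W :: 'd pospace).
      \<forall>R \<in> pgps_hom X Y. \<forall>S \<in> pgps_hom Y Z. \<forall>T \<in> pgps_hom Z W.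
      pgps_comp X Z W T (pgps_comp X Y Z S R) = pgps_comp X Y W (pgps_comp Y Z W T S) R) \<and>

   \<comment> \<open>contravariant functor from spaces to frames\<close>
   (\<forall>X :: 'a pospace. pointed_gen_priestley_space X \<longrightarrow> algebraic_frame (V_ob X)) \<and>
   (\<forall>(X :: 'a pospace) (Y :: 'b pospace). \<forall>R \<in> pgps_hom X Y.
      V_mor X Y R \<in> frm_hom (V_ob Y) (V_ob X)) \<and>
   (\<forall>X :: 'a pospace. pointed_gen_priestley_space X \<longrightarrow>
      V_mor X X (pgps_id X) = frm_id (V_ob X)) \<and>
   (\<forall>(X :: 'a pospace) (Y :: 'b pospace) (Z :: 'c pospace). \<forall>R \<in> pgps_hom X Y. \<forall>S \<in> pgps_hom Y Z.
      V_mor X Z (pgps_comp X Y Z S R) = frm_comp (V_ob Z) (V_mor X Y R) (V_mor Y Z S)) \<and>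

   \<comment> \<open>contravariant functor from frames to spaces\<close>
   (\<forall>L :: 'a gorder. algebraic_frame L \<longrightarrow> pointed_gen_priestley_space (Y_ob L)) \<and>
   (\<forall>(L :: 'a gorder) (M :: 'b gorder). \<forall>\<alpha> \<in> frm_hom L M.
      Y_mor L M \<alpha> \<in> pgps_hom (Y_ob M) (Y_ob L)) \<and>
   (\<forall>L :: 'a gorder. algebraic_frame L \<longrightarrow> Y_mor L L (frm_id L) = pgps_id (Y_ob L)) \<and>
   (\<forall>(L :: 'a gorder) (M :: 'b gorder) (N :: 'c gorder). \<forall>\<alpha> \<in> frm_hom L M. \<forall>\<beta> \<in> frm_hom M N.
      Y_mor L N (frm_comp L \<beta> \<alpha>)
        = pgps_comp (Y_ob N) (Y_ob M) (Y_ob L) (Y_mor L M \<alpha>) (Y_mor M N \<beta>)) \<and>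

   \<comment> \<open>natural isomorphism on frames\<close>
   (\<forall>L :: 'a gorder. algebraic_frame L \<longrightarrow> frm_unit L \<in> frm_iso L (V_ob (Y_ob L))) \<and>
   (\<forall>(L :: 'a gorder) (M :: 'b gorder). \<forall>\<alpha> \<in> frm_hom L M.
      frm_comp L (V_mor (Y_ob M) (Y_ob L) (Y_mor L M \<alpha>)) (frm_unit L)
        = frm_comp L (frm_unit M) \<alpha>) \<and>

   \<comment> \<open>natural isomorphism on spaces\<close>
   (\<forall>X :: 'a pospace. pointed_gen_priestley_space X \<longrightarrow>
      pgps_unit X \<in> pgps_iso X (Y_ob (V_ob X))) \<and>
   (\<forall>(X :: 'a pospace) (Y :: 'b pospace). \<forall>R \<in> pgps_hom X Y.
      pgps_comp X (Y_ob (V_ob X)) (Y_ob (V_ob Y))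
          (Y_mor (V_ob Y) (V_ob X) (V_mor X Y R)) (pgps_unit X)
        = pgps_comp X Y (Y_ob (V_ob Y)) (pgps_unit Y) R)"
  by (intro conjI allI ballI impI
      frm_id_hom frm_comp_hom frm_comp_id frm_comp_assoc
      pgps_id_hom pgps_comp_hom pgps_comp_id pgps_comp_assoc
      pointed_gen_priestley_space.V_ob_algebraic_frame V_mor_hom V_mor_id V_mor_comp
      Y_ob_pgps Y_mor_hom Y_mor_id Y_mor_comp
      frm_unit_iso frm_unit_natural pgps_unit_iso pgps_unit_natural)

end
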